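(* Let $(Q,N,C_1,C_2,\dots)$ be a nonnegative random vector with $N\in\{0,1,2,\dots\}\cup\{\infty\}$ and $P(Q>0)>0$, and let $R^{(n)}=\sum_{k=0}^nW_k$ and $R=\sum_{k=0}^\infty W_k$ be defined on the associated weighted branching tree (see context). Write $\rho_\beta=E\left[\sum_{i=1}^N C_i^\beta\right]$ and $\rho=\rho_1$. Assume that $E[Q^\beta] < \infty$ for some $\beta > 0$. In addition, suppose that either (i) $\rho_\beta < 1$ if $0 < \beta < 1$, or (ii) $(\rho \vee \rho_\beta) < 1$ and $E\left[\left( \sum_{i=1}^N C_i \right)^\beta\right] < \infty$ if $\beta \geq 1$. Then $E[R^\gamma] < \infty$ for all $0 < \gamma \leq \beta$, and in particular, $R < \infty$ a.s. Moreover, if $\beta \geq 1$, then $R^{(n)} \to R$ in $L_\beta$, i.e., in the norm $(E|\cdot|^\beta)^{1/\beta}$.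
   Context: Let $U=\bigcup_{k=0}^\infty \{1,2,3,\dots\}^k$, with $\{1,2,\dots\}^0=\{\emptyset\}$; $(\mathbf{i},j)$ denotes concatenation, $(\emptyset,j)=j$. Let $\{(Q_{\mathbf i}, N_{\mathbf i}, C_{(\mathbf i,1)}, C_{(\mathbf i,2)},\dots)\}_{\mathbf i\in U}$ be iid copies of $(Q,N,C_1,C_2,\dots)$, the copy at the root $\emptyset$ being $(Q,N,C_1,C_2,\dots)$ itself. Put $A_0=\{\emptyset\}$ and $A_n=\{(i_1,\dots,i_n)\in U: (i_1,\dots,i_{n-1})\in A_{n-1},\ 1\le i_n\le N_{(i_1,\dots,i_{n-1})}\}$ for $n\ge1$. The weights are $\Pi_\emptyset=1$ and $\Pi_{(i_1,\dots,i_n)}=C_{(i_1,\dots,i_n)}\Pi_{(i_1,\dots,i_{n-1})}$. Define $W_n=\sum_{\mathbf i\in A_n}Q_{\mathbf i}\Pi_{\mathbf i}$, $n\ge0$ (so $W_0=Q$). $a\vee b$ denotes $\max\{a,b\}$. *)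

theory Defs
  imports "HOL-Probability.Probability"
begin

text \<open>
  Nodes of the tree are lists of positive naturals, the root being the empty list, and
  the concatenation (i, j) is \<open>i @ [j]\<close>.  The family \<open>C\<close> is indexed by the child, so that the mark
  attached to node \<open>i\<close> is (Q i, N i, C (i @ [1]), C (i @ [2]), ...); values at lists containing 0,
  and \<open>C []\<close>, are never used.  All sums of nonnegative terms are taken in \<^typ>\<open>ennreal\<close>.
\<close>

definition U :: "nat list set" where
  "U = {i. \<forall>j\<in>set i. 1 \<le> j}"

definition mark_space :: "(real \<times> enat \<times> (nat \<Rightarrow> real)) measure" where
  "mark_space = borel \<Otimes>\<^sub>M count_space UNIV \<Otimes>\<^sub>M Pi\<^sub>M {1..} (\<lambda>_. borel)"

definition mark ::
  "(nat list \<Rightarrow> 'a \<Rightarrow> real) \<Rightarrow> (nat list \<Rightarrow> 'a \<Rightarrow> enat) \<Rightarrow> (nat list \<Rightarrow> 'a \<Rightarrow> real)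
    \<Rightarrow> nat list \<Rightarrow> 'a \<Rightarrow> real \<times> enat \<times> (nat \<Rightarrow> real)" where
  "mark Q N C i \<omega> = (Q i \<omega>, N i \<omega>, \<lambda>j\<in>{1..}. C (i @ [j]) \<omega>)"

definition iid_marks ::
  "'a measure \<Rightarrow> (nat list \<Rightarrow> 'a \<Rightarrow> real) \<Rightarrow> (nat list \<Rightarrow> 'a \<Rightarrow> enat) \<Rightarrow> (nat list \<Rightarrow> 'a \<Rightarrow> real)
    \<Rightarrow> bool" where
  "iid_marks M Q N C \<longleftrightarrow>
     prob_space.indep_vars M (\<lambda>_. mark_space) (mark Q N C) U \<and>
     (\<forall>i\<in>U. distr M mark_space (mark Q N C i) = distr M mark_space (mark Q N C []))"

primrec A :: "(nat list \<Rightarrow> 'a \<Rightarrow> enat) \<Rightarrow> 'a \<Rightarrow> nat \<Rightarrow> nat list set" where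
  "A N \<omega> 0 = {[]}"
| "A N \<omega> (Suc n) = {i @ [j] | i j. i \<in> A N \<omega> n \<and> 1 \<le> j \<and> enat j \<le> N i \<omega>}"

function weight :: "(nat list \<Rightarrow> 'a \<Rightarrow> real) \<Rightarrow> 'a \<Rightarrow> nat list \<Rightarrow> real" where
  "weight C \<omega> [] = 1"
| "weight C \<omega> (i @ [j]) = C (i @ [j]) \<omega> * weight C \<omega> i"
  by (metis prod_cases3 rev_exhaust) auto
termination
  by (relation "Wellfounded.measure (\<lambda>(C, \<omega>, i). length i)") auto

definition W ::
  "(nat list \<Rightarrow> 'a \<Rightarrow> real) \<Rightarrow> (nat list \<Rightarrow> 'a \<Rightarrow> enat) \<Rightarrow> (nat list \<Rightarrow> 'a \<Rightarrow> real)
    \<Rightarrow> nat \<Rightarrow> 'a \<Rightarrow> ennreal" where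
  "W Q N C n \<omega> = (\<Sum>\<^sub>\<infinity>i\<in>A N \<omega> n. ennreal (Q i \<omega> * weight C \<omega> i))"

definition R_part ::
  "(nat list \<Rightarrow> 'a \<Rightarrow> real) \<Rightarrow> (nat list \<Rightarrow> 'a \<Rightarrow> enat) \<Rightarrow> (nat list \<Rightarrow> 'a \<Rightarrow> real)
    \<Rightarrow> nat \<Rightarrow> 'a \<Rightarrow> ennreal" where
  "R_part Q N C n \<omega> = (\<Sum>k=0..n. W Q N C k \<omega>)"

definition R ::
  "(nat list \<Rightarrow> 'a \<Rightarrow> real) \<Rightarrow> (nat list \<Rightarrow> 'a \<Rightarrow> enat) \<Rightarrow> (nat list \<Rightarrow> 'a \<Rightarrow> real)
    \<Rightarrow> 'a \<Rightarrow> ennreal" where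
  "R Q N C \<omega> = (\<Sum>k. W Q N C k \<omega>)"

text \<open>Powers with positive real exponent on [0, \<open>\<infinity>\<close>]; only used for \<open>p > 0\<close>.\<close>

definition ennpowr :: "ennreal \<Rightarrow> real \<Rightarrow> ennreal" where
  "ennpowr x p = (if x = \<infinity> then \<infinity> else ennreal (enn2real x powr p))"

text \<open>The sum of the \<open>p\<close>-th powers of the weights \<open>C\<^sub>1, ..., C\<^sub>N\<close> at the root (\<open>N = \<infinity>\<close> allowed).\<close>

definition offspring_sum ::
  "(nat list \<Rightarrow> 'a \<Rightarrow> enat) \<Rightarrow> (nat list \<Rightarrow> 'a \<Rightarrow> real) \<Rightarrow> real \<Rightarrow> 'a \<Rightarrow> ennreal" where
  "offspring_sum N C p \<omega> = (\<Sum>\<^sub>\<infinity>j\<in>{j. 1 \<le> j \<and> enat j \<le> N [] \<omega>}. ennreal (C [j] \<omega> powr p))"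

definition rho ::
  "'a measure \<Rightarrow> (nat list \<Rightarrow> 'a \<Rightarrow> enat) \<Rightarrow> (nat list \<Rightarrow> 'a \<Rightarrow> real) \<Rightarrow> real \<Rightarrow> ennreal" where
  "rho M N C p = (\<integral>\<^sup>+\<omega>. offspring_sum N C p \<omega> \<partial>M)"

definition Lp_norm :: "'a measure \<Rightarrow> real \<Rightarrow> ('a \<Rightarrow> real) \<Rightarrow> ennreal" where
  "Lp_norm M p X = ennpowr (\<integral>\<^sup>+\<omega>. ennreal (\<bar>X \<omega>\<bar> powr p) \<partial>M) (1 / p)"

definition in_Lp :: "'a measure \<Rightarrow> real \<Rightarrow> ('a \<Rightarrow> real) \<Rightarrow> bool" where
  "in_Lp M p X \<longleftrightarrow> X \<in> borel_measurable M \<and> Lp_norm M p X < \<infinity>"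

definition converges_in_Lp ::
  "'a measure \<Rightarrow> real \<Rightarrow> (nat \<Rightarrow> 'a \<Rightarrow> real) \<Rightarrow> ('a \<Rightarrow> real) \<Rightarrow> bool" where
  "converges_in_Lp M p X Y \<longleftrightarrow>
     (\<forall>n. in_Lp M p (X n)) \<and> in_Lp M p Y \<and>
     (\<lambda>n. Lp_norm M p (\<lambda>\<omega>. X n \<omega> - Y \<omega>)) \<longlonglongrightarrow> 0"

end

theory Submission
  imports Defs
begin

text \<open>
  The total \<open>R\<close> is the sum of the generations \<open>W n\<close>, so it suffices that the \<open>\<beta>\<close>-th moments of the
  \<open>W n\<close> decay geometrically: a geometric decay survives summation, by subadditivity of the power
  when \<open>\<beta> \<le> 1\<close> (\<open>moment_suminf_finite_le_one\<close>) and by Jensen's inequality with geometric weights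
  when \<open>\<beta> > 1\<close> (\<open>moment_suminf_finite_gt_one\<close>).  Lower moments and almost sure finiteness follow
  from the \<open>\<beta>\<close>-th moment, and convergence in \<open>L\<^sub>\<beta>\<close> is dominated convergence with dominating
  function \<open>R\<^sup>\<beta>\<close>.

  For \<open>\<beta> \<le> 1\<close> subadditivity gives at once \<open>E[W n ^ \<beta>] \<le> \<rho>\<^sub>\<beta> ^ n * E[Q ^ \<beta>]\<close>.

  For \<open>\<beta> > 1\<close> let \<open>Z n\<close> be the total weight of generation \<open>n\<close>.  Given the weights of generation
  \<open>n\<close>, \<open>W n\<close> is a weighted sum of independent copies of \<open>Q\<close>, so Jensen's inequality reduces \<open>W n\<close> to
  \<open>Z n\<close>.  In turn \<open>Z (n + 1)\<close> is the sum \<open>T\<close> over generation \<open>n\<close> of terms \<open>x v\<close>, where \<open>x v\<close> is the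
  weight of \<open>v\<close> times an independent copy of the root's offspring weight, whose mean is \<open>\<rho> < 1\<close>.
  Expand \<open>T ^ \<beta>\<close> as the sum of \<open>x v * T ^ (\<beta> - 1)\<close> and compare \<open>T ^ (\<beta> - 1)\<close> with a large multiple
  of \<open>x v ^ (\<beta> - 1)\<close> plus \<open>d\<close> times the power of \<open>T - x v\<close>, with \<open>d > 1\<close> as close to 1 as
  desired.  The first kind of term contributes at most a constant times \<open>\<rho>\<^sub>\<beta> ^ n\<close>.  In the second,
  the copy at \<open>v\<close> is independent of the weight of \<open>v\<close> and of \<open>T - x v\<close>, and Young's inequality absorbs
  the remaining power of \<open>T\<close>.  The result is \<open>E[Z (n + 1) ^ \<beta>] \<le> const * \<rho>\<^sub>\<beta> ^ n + (d * \<rho>) ^ \<beta> * E[Z n ^ \<beta>]\<close>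
  (\<open>level_sum_moment_largest_or_mean\<close>), and with \<open>d * \<rho> < 1\<close> this forces geometric decay.

  Throughout, nonnegative sums are integrals against a counting measure, so that interchanging them
  with expectations is Tonelli's theorem.
\<close>

section \<open>Power inequalities on the extended nonnegative reals\<close>

lemma ennpowr_ennreal: "0 \<le> x \<Longrightarrow> ennpowr (ennreal x) p = ennreal (x powr p)"
  by (simp add: ennpowr_def)

lemma ennpowr_top [simp]: "ennpowr \<top> p = \<top>"
  by (simp add: ennpowr_def)

lemma ennpowr_0 [simp]: "ennpowr 0 p = 0"
  by (simp add: ennpowr_def)

lemma ennpowr_1 [simp]: "ennpowr 1 p = 1"
  by (simp add: ennpowr_def)

lemma ennpowr_one_exponent [simp]: "ennpowr x 1 = x"
  by (cases x) (simp_all add: ennpowr_ennreal)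

lemma ennpowr_eq_0_iff [simp]: "ennpowr x p = 0 \<longleftrightarrow> x = 0"
  by (cases x) (simp_all add: ennpowr_ennreal ennreal_eq_0_iff antisym_conv)

lemma ennpowr_eq_top_iff [simp]: "ennpowr x p = \<top> \<longleftrightarrow> x = \<top>"
  by (cases x) (simp_all add: ennpowr_ennreal)

lemma ennpowr_less_top_iff [simp]: "ennpowr x p < \<top> \<longleftrightarrow> x < \<top>"
  by (simp add: less_top[symmetric])

lemma ennpowr_mono:
  assumes "0 < p" "x \<le> y" shows "ennpowr x p \<le> ennpowr y p"
  using assms by (cases x; cases y) (auto simp: ennpowr_ennreal intro!: ennreal_leI powr_mono2 simp: top_unique)

lemma ennpowr_mult:
  assumes "0 < p" shows "ennpowr (x * y) p = ennpowr x p * ennpowr y p"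
  using assms
  by (cases "x = 0 \<or> y = 0"; cases x; cases y)
     (auto simp: ennpowr_ennreal powr_mult ennreal_mult[symmetric] ennreal_mult_top ennreal_top_mult)

lemma ennpowr_ennpowr:
  shows "ennpowr (ennpowr x p) q = ennpowr x (p * q)"
  by (cases x) (simp_all add: ennpowr_ennreal powr_powr)

lemma ennpowr_add:
  assumes "0 < p" "0 < q" shows "ennpowr x p * ennpowr x q = ennpowr x (p + q)"
  by (cases x) (simp_all add: ennpowr_ennreal powr_add ennreal_mult[symmetric] ennreal_top_mult)

lemma mult_ennpowr:
  assumes "1 < p" shows "x * ennpowr x (p - 1) = ennpowr x p"
  using ennpowr_add[of 1 "p - 1" x] assms by simp

lemma measurable_ennpowr [measurable]: "(\<lambda>x. ennpowr x p) \<in> borel_measurable borel"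
  unfolding ennpowr_def by measurable

lemma ennpowr_le_one_plus:
  assumes "0 < g" "g \<le> b" shows "ennpowr x g \<le> 1 + ennpowr x b"
proof (cases x)
  case (real r)
  have "r powr g \<le> 1 + r powr b"
  proof (cases "r \<le> 1")
    case True
    with real assms have "r powr g \<le> 1" by (simp add: powr_le1)
    then show ?thesis by (simp add: add_increasing2)
  next
    case False
    with assms have "r powr g \<le> r powr b" by (simp add: powr_mono)
    then show ?thesis by simp
  qed
  then show ?thesis using real
    by (simp add: ennpowr_ennreal ennreal_plus[symmetric] ennreal_1[symmetric] del: ennreal_plus ennreal_1)
qed simp

text \<open>Young's inequality for the conjugate exponents \<open>p\<close> and \<open>p / (p - 1)\<close>, cleared of denominators.\<close>
lemma ennpowr_Young:
  assumes p: "1 < p"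
  shows "ennreal p * x * ennpowr s (p - 1) \<le> ennpowr x p + ennreal (p - 1) * ennpowr s p"
proof (cases "x = \<top> \<or> s = \<top>")
  case True with p show ?thesis by (auto simp: ennreal_mult_top)
next
  case False
  then obtain a b where x: "x = ennreal a" "0 \<le> a" and s: "s = ennreal b" "0 \<le> b"
    by (cases x; cases s) auto
  define q where "q = p / (p - 1)"
  have "a * b powr (p - 1) \<le> a powr p / p + (b powr (p - 1)) powr q / q"
    using p x s by (intro Youngs_inequality) (auto simp: q_def field_simps)
  also have "(b powr (p - 1)) powr q / q = (p - 1) * b powr p / p"
    using p by (simp add: powr_powr q_def)
  finally have "p * a * b powr (p - 1) \<le> a powr p + (p - 1) * b powr p"
    using p by (simp add: field_simps)
  then show ?thesis using p
    by (simp add: x s ennpowr_ennreal ennreal_mult[symmetric] ennreal_plus[symmetric] del: ennreal_plus)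
qed

text \<open>
  The constant in front of one of the two summands can be brought as close to 1 as desired: with
  \<open>\<delta> = d powr (1/q) - 1\<close>, either \<open>x \<le> \<delta> * y\<close> and then \<open>x + y \<le> d powr (1/q) * y\<close>, or \<open>y\<close> is at most
  \<open>x / \<delta>\<close>.
\<close>
lemma ennpowr_add_le:
  assumes q: "0 < q" and d: "1 < (d::real)"
  obtains K :: real where "0 \<le> K"
    "\<And>x y. ennpowr (x + y) q \<le> ennreal K * ennpowr x q + ennreal d * ennpowr y q"
proof
  define \<delta> where "\<delta> = d powr (1/q) - 1"
  define K where "K = (1 + 1/\<delta>) powr q"
  have \<delta>: "0 < \<delta>" using q d by (simp add: \<delta>_def)
  have \<delta>q: "(1 + \<delta>) powr q = d" using q d by (simp add: \<delta>_def powr_powr)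
  show "0 \<le> K" by (simp add: K_def)
  have real: "(a + b) powr q \<le> K * a powr q + d * b powr q" if "0 \<le> a" "0 \<le> b" for a b
  proof (cases "a \<le> \<delta> * b")
    case True
    then have "(a + b) powr q \<le> ((1 + \<delta>) * b) powr q"
      using that q by (intro powr_mono2) (auto simp: algebra_simps)
    also have "\<dots> = d * b powr q" using that \<delta> by (simp add: powr_mult \<delta>q)
    finally show ?thesis by (simp add: K_def add_increasing)
  next
    case False
    then have "(a + b) powr q \<le> ((1 + 1/\<delta>) * a) powr q"
      using that q \<delta> by (intro powr_mono2) (auto simp: field_simps)
    also have "\<dots> = K * a powr q" using that \<delta> by (simp add: powr_mult K_def)
    finally show ?thesis using d by (simp add: add_increasing2)
  qed
  fix x y :: ennreal
  show "ennpowr (x + y) q \<le> ennreal K * ennpowr x q + ennreal d * ennpowr y q"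
  proof (cases "x = \<top> \<or> y = \<top>")
    case True
    have "1 + 1/\<delta> > 0" using \<delta> by (intro add_pos_pos) auto
    then have "K > 0" by (simp add: K_def)
    with True d show ?thesis by (auto simp: ennreal_mult_top)
  next
    case False
    then obtain a b where "x = ennreal a" "0 \<le> a" "y = ennreal b" "0 \<le> b"
      by (cases x; cases y) auto
    then show ?thesis using real[of a b] d
      by (simp add: ennpowr_ennreal ennreal_mult[symmetric] ennreal_plus[symmetric] K_def del: ennreal_plus)
  qed
qed

text \<open>
  With \<open>s\<close> the right-hand side, every term satisfies \<open>x i ^ p \<le> s\<close>, so that
  \<open>x i = x i ^ p * (x i ^ p) ^ ((1 - p) / p) \<le> x i ^ p * s ^ ((1 - p) / p)\<close>; summing gives \<open>s ^ (1 / p)\<close>.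
\<close>
lemma ennpowr_subadditive:
  assumes p: "0 < p" "p \<le> 1"
  shows "ennpowr (\<integral>\<^sup>+i. x i \<partial>count_space I) p \<le> (\<integral>\<^sup>+i. ennpowr (x i) p \<partial>count_space I)"
proof -
  define s where "s = (\<integral>\<^sup>+i. ennpowr (x i) p \<partial>count_space I)"
  have x_le: "x i \<le> ennpowr (x i) p * ennpowr s ((1 - p) / p)" if "i \<in> I" for i
  proof (cases "p = 1 \<or> s = 0")
    case True
    moreover have "ennpowr (x i) p \<le> s"
      unfolding s_def using that by (rule nn_integral_ge_point)
    moreover have "x i = 0 \<or> ennpowr s 0 \<ge> 1" if "p = 1"
      using \<open>ennpowr (x i) p \<le> s\<close> that by (cases s) (auto simp: ennpowr_ennreal)
    ultimately show ?thesis
      using mult_left_mono[of 1 "ennpowr s 0" "x i"] by auto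
  next
    case False
    have "ennpowr (ennpowr (x i) p) ((1 - p) / p) \<le> ennpowr s ((1 - p) / p)"
      unfolding s_def using False p that by (intro ennpowr_mono nn_integral_ge_point) auto
    then have "ennpowr (x i) p * ennpowr (x i) (1 - p) \<le> ennpowr (x i) p * ennpowr s ((1 - p) / p)"
      using p by (intro mult_left_mono) (auto simp: ennpowr_ennpowr)
    then show ?thesis using p False by (simp add: ennpowr_add)
  qed
  have "(\<integral>\<^sup>+i. x i \<partial>count_space I) \<le> (\<integral>\<^sup>+i. ennpowr (x i) p * ennpowr s ((1 - p) / p) \<partial>count_space I)"
    using x_le by (intro nn_integral_mono) simp
  also have "\<dots> = s * ennpowr s ((1 - p) / p)"
    by (simp add: nn_integral_multc s_def)
  also have "\<dots> = ennpowr s (1 / p)"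
    using p by (cases "p = 1"; cases s)
      (auto simp: ennpowr_ennreal ennreal_mult[symmetric] ennreal_top_mult powr_mult_base diff_divide_distrib)
  finally have "ennpowr (\<integral>\<^sup>+i. x i \<partial>count_space I) p \<le> ennpowr (ennpowr s (1 / p)) p"
    using p by (intro ennpowr_mono) auto
  then show ?thesis using p by (simp add: ennpowr_ennpowr s_def)
qed

text \<open>
  Jensen's inequality for the convex power, without normalizing the weights.  Young's inequality is the
  tangent line bound at an arbitrary point \<open>t\<close>; the choice \<open>t = S / Z\<close> (the weighted mean) is optimal.
\<close>
lemma ennpowr_weighted_sum_Jensen:
  assumes p: "1 < p"
  shows "ennpowr (\<integral>\<^sup>+i. a i * y i \<partial>count_space I) p
    \<le> ennpowr (\<integral>\<^sup>+i. a i \<partial>count_space I) (p - 1) * (\<integral>\<^sup>+i. a i * ennpowr (y i) p \<partial>count_space I)"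
proof -
  define S where "S = (\<integral>\<^sup>+i. a i * y i \<partial>count_space I)"
  define Z where "Z = (\<integral>\<^sup>+i. a i \<partial>count_space I)"
  define B where "B = (\<integral>\<^sup>+i. a i * ennpowr (y i) p \<partial>count_space I)"
  have tangent: "ennreal p * S * ennpowr t (p - 1) \<le> B + ennreal (p - 1) * ennpowr t p * Z" for t
  proof -
    have "ennreal p * S * ennpowr t (p - 1)
        = (\<integral>\<^sup>+i. a i * (ennreal p * y i * ennpowr t (p - 1)) \<partial>count_space I)"
      unfolding S_def by (simp add: nn_integral_cmult[symmetric] nn_integral_multc[symmetric] mult_ac)
    also have "\<dots> \<le> (\<integral>\<^sup>+i. a i * (ennpowr (y i) p + ennreal (p - 1) * ennpowr t p) \<partial>count_space I)"
      by (intro nn_integral_mono mult_left_mono ennpowr_Young p) simp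
    also have "\<dots> = B + ennreal (p - 1) * ennpowr t p * Z"
      by (simp add: distrib_left nn_integral_add nn_integral_multc B_def Z_def mult_ac)
    finally show ?thesis .
  qed
  \<comment> \<open>The tangent point \<open>S / Z\<close> makes sense only in the last case; the others involve \<open>0\<close> or \<open>\<top>\<close>.\<close>
  consider "S = 0" | "S \<noteq> 0" "Z = \<top>" | "S = \<top>" "Z < \<top>" | "S \<noteq> 0" "S < \<top>" "Z < \<top>"
    by (auto simp: less_top[symmetric])
  then have "ennpowr S p \<le> ennpowr Z (p - 1) * B"
  proof cases
    case 2
    have "B \<noteq> 0" 
    proof
      assume "B = 0"
      then have "a i * ennpowr (y i) p = 0" if "i \<in> I" for i
        using that by (simp add: B_def nn_integral_0_iff_AE AE_count_space)
      then have "S = 0" unfolding S_def by (auto simp: nn_integral_0_iff_AE AE_count_space)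
      with 2 show False by simp
    qed
    with 2 show ?thesis by (simp add: ennreal_top_mult)
  next
    case 3
    have "B + ennreal (p - 1) * Z = \<top>"
      using tangent[of 1] 3 p by (simp add: ennreal_mult_top top_unique)
    with 3 have "B = \<top>" by (auto simp: ennreal_mult_eq_top_iff ennreal_add_eq_top)
    moreover have "Z \<noteq> 0"
    proof
      assume "Z = 0"
      then have "S = 0" by (auto simp: Z_def S_def nn_integral_0_iff_AE AE_count_space)
      with 3 show False by simp
    qed
    ultimately show ?thesis by (simp add: ennreal_mult_top)
  next
    case 4
    have "Z \<noteq> 0"
    proof
      assume "Z = 0"
      then have "S = 0" by (auto simp: Z_def S_def nn_integral_0_iff_AE AE_count_space)
      with 4 show False by simp
    qed
    show ?thesis
    proof (cases B)
      case top
      with \<open>Z \<noteq> 0\<close> show ?thesis by (simp add: ennreal_mult_top)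
    next
      case (real b)
      obtain s z where s: "S = ennreal s" "0 < s" and z: "Z = ennreal z" "0 < z"
        using 4 \<open>Z \<noteq> 0\<close> by (cases S; cases Z) (auto simp: ennreal_eq_0_iff not_le)
      have "p * s * (s / z) powr (p - 1) \<le> b + (p - 1) * (s / z) powr p * z"
        using tangent[of "ennreal (s / z)"] s z p real
        by (simp add: ennpowr_ennreal ennreal_mult[symmetric] ennreal_plus[symmetric] del: ennreal_plus)
      moreover have "s * (s / z) powr (p - 1) = s powr p / z powr (p - 1)"
        "(s / z) powr p * z = s powr p / z powr (p - 1)"
        using s z by (simp_all add: powr_divide powr_diff field_simps)
      ultimately have "p * (s powr p / z powr (p - 1)) \<le> b + (p - 1) * (s powr p / z powr (p - 1))"
        by (simp add: mult.assoc)
      then have "s powr p / z powr (p - 1) \<le> b" by (simp add: left_diff_distrib diff_divide_distrib)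
      then have "s powr p \<le> z powr (p - 1) * b" using z by (simp add: field_simps)
      then show ?thesis using s z real
        by (simp add: ennpowr_ennreal ennreal_mult[symmetric])
    qed
  qed simp
  then show ?thesis unfolding S_def Z_def B_def .
qed

section \<open>Countable sums as integrals\<close>

lemma infsum_ennreal_eq_nn_integral:
  fixes f :: "'b \<Rightarrow> ennreal"
  assumes "countable I"
  shows "infsum f I = (\<integral>\<^sup>+i. f i \<partial>count_space I)"
proof (cases "finite I")
  case True
  then show ?thesis by (simp add: nn_integral_count_space_finite)
next
  case False
  note bij = bij_betw_from_nat_into[OF assms False]
  have "infsum f I = infsum (\<lambda>n. f (from_nat_into I n)) UNIV"
    by (rule infsum_reindex_bij_betw[OF bij, symmetric])
  also have "\<dots> = (\<Sum>n. f (from_nat_into I n))"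
    by (intro sums_unique has_sum_imp_sums has_sum_infsum nonneg_summable_on_complete) auto
  also have "\<dots> = (\<integral>\<^sup>+i. f i \<partial>count_space I)"
    by (simp add: nn_integral_bij_count_space[OF bij, symmetric] nn_integral_count_space_nat)
  finally show ?thesis .
qed

lemma borel_measurable_nn_integral_count_space:
  fixes F :: "'b \<Rightarrow> 'c \<Rightarrow> ennreal"
  assumes "countable I" and F: "\<And>i. i \<in> I \<Longrightarrow> F i \<in> borel_measurable N"
  shows "(\<lambda>\<omega>. \<integral>\<^sup>+i. F i \<omega> \<partial>count_space I) \<in> borel_measurable N"
proof -
  have "(\<lambda>p. F (fst p) (snd p)) \<in> borel_measurable (count_space I \<Otimes>\<^sub>M N)"
    using F by (intro measurable_pair_measure_countable1 assms) simp
  then have "(\<lambda>(\<omega>, i). F i \<omega>) \<in> borel_measurable (N \<Otimes>\<^sub>M count_space I)"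
    by (subst measurable_pair_swap_iff) (simp add: case_prod_beta)
  then show ?thesis
    by (rule sigma_finite_measure.borel_measurable_nn_integral
        [OF sigma_finite_measure_count_space_countable[OF \<open>countable I\<close>]])
qed

section \<open>Generations of the tree of all nodes\<close>

definition level :: "nat \<Rightarrow> nat list set" where
  "level n = {v \<in> U. length v = n}"

lemma level_0 [simp]: "level 0 = {[]}"
  by (auto simp: level_def U_def)

lemma countable_level [simp]: "countable (level n)"
  by (rule countableI_type)

lemma take_in_U: "v \<in> U \<Longrightarrow> take k v \<in> U"
  using set_take_subset[of k v] by (auto simp: U_def)

lemma bij_betw_level_Suc: "bij_betw (\<lambda>(v, j). v @ [j]) (level n \<times> {1..}) (level (Suc n))"
proof (rule bij_betw_byWitness[where f' = "\<lambda>v. (butlast v, last v)"])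
  show "(\<lambda>v. (butlast v, last v)) ` level (Suc n) \<subseteq> level n \<times> {1..}"
  proof clarify
    fix v assume v: "v \<in> level (Suc n)"
    then obtain w j where "v = w @ [j]" by (cases v rule: rev_cases) (auto simp: level_def)
    with v show "butlast v \<in> level n \<and> last v \<in> {1..}" by (auto simp: level_def U_def)
  qed
qed (auto simp: level_def U_def intro!: append_butlast_last_id)

lemma nn_integral_level_Suc:
  "(\<integral>\<^sup>+v. f v \<partial>count_space (level (Suc n)))
    = (\<integral>\<^sup>+v. \<integral>\<^sup>+j. f (v @ [j]) \<partial>count_space {1..} \<partial>count_space (level n))"
proof -
  interpret sigma_finite_measure "count_space {1::nat..}"
    by (rule sigma_finite_measure_count_space)
  have "(\<integral>\<^sup>+v. \<integral>\<^sup>+j. f (v @ [j]) \<partial>count_space {1..} \<partial>count_space (level n))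
      = (\<integral>\<^sup>+p. f (fst p @ [snd p]) \<partial>(count_space (level n) \<Otimes>\<^sub>M count_space {1..}))"
    by (subst nn_integral_fst[symmetric]) (auto simp: pair_measure_countable)
  also have "\<dots> = (\<integral>\<^sup>+v. f v \<partial>count_space (level (Suc n)))"
    by (simp add: pair_measure_countable case_prod_beta
        nn_integral_bij_count_space[OF bij_betw_level_Suc, symmetric])
  finally show ?thesis ..
qed

section \<open>Moments of weighted sums over a generation\<close>

text \<open>
  Marks are abstract here.  A child that does not belong to the tree is represented by the weight 0, so
  that all sums range over the deterministic set of all nodes of a generation.
\<close>
locale weighted_branching_tree = prob_space M
  for M :: "'a measure" +
  fixes S :: "'m measure" and X :: "nat list \<Rightarrow> 'a \<Rightarrow> 'm" and c :: "nat \<Rightarrow> 'm \<Rightarrow> ennreal"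
  assumes indep_marks: "indep_vars (\<lambda>_. S) X U"
    and distr_mark: "v \<in> U \<Longrightarrow> distr M S (X v) = distr M S (X [])"
    and measurable_child_weight: "1 \<le> j \<Longrightarrow> c j \<in> borel_measurable S"
begin

lemma measurable_mark: "v \<in> U \<Longrightarrow> X v \<in> measurable M S"
  using indep_marks by (simp add: indep_vars_def)

lemma Nil_in_U [simp]: "[] \<in> U" by (simp add: U_def)

lemma nn_integral_mark:
  assumes "v \<in> U" and [measurable]: "f \<in> borel_measurable S"
  shows "(\<integral>\<^sup>+\<omega>. f (X v \<omega>) \<partial>M) = (\<integral>\<^sup>+\<omega>. f (X [] \<omega>) \<partial>M)"
proof -
  have "(\<integral>\<^sup>+\<omega>. f (X u \<omega>) \<partial>M) = (\<integral>\<^sup>+x. f x \<partial>distr M S (X u))" if "u \<in> U" for u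
    using measurable_mark[OF that] by (simp add: nn_integral_distr)
  then show ?thesis using distr_mark[OF assms(1)] assms(1) by simp
qed

text \<open>The information carried by all marks except the one at \<open>v\<close>.\<close>
definition rest :: "nat list \<Rightarrow> 'a measure" where
  "rest v = sigma (space M) (\<Union>u\<in>U - {v}. {X u -` B \<inter> space M |B. B \<in> sets S})"

lemma space_rest: "space (rest v) = space M"
  unfolding rest_def by (rule space_measure_of) auto

lemma sets_rest:
  "sets (rest v) = sigma_sets (space M) (\<Union>u\<in>U - {v}. {X u -` B \<inter> space M |B. B \<in> sets S})"
  unfolding rest_def by (rule sets_measure_of) auto

lemma measurable_mark_rest:
  assumes "u \<in> U" "u \<noteq> v" shows "X u \<in> measurable (rest v) S"
proof (rule measurableI)
  show "X u \<omega> \<in> space S" if "\<omega> \<in> space (rest v)" for \<omega>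
    using measurable_space[OF measurable_mark[OF assms(1)]] that by (simp add: space_rest)
  show "X u -` B \<inter> space (rest v) \<in> sets (rest v)" if "B \<in> sets S" for B
    unfolding sets_rest space_rest using that assms by (intro sigma_sets.Basic) auto
qed

lemma measurable_restD:
  assumes "g \<in> measurable (rest v) N" shows "g \<in> measurable M N"
proof -
  have "sets (rest v) \<subseteq> sets M"
    unfolding sets_rest using measurable_sets[OF measurable_mark]
    by (intro sets.sigma_sets_subset) auto
  then show ?thesis
    using measurable_mono[of N N "rest v" M] assms by (auto simp: space_rest)
qed

text \<open>
  The only use of independence.  It replaces conditioning on the past: whatever multiplies the mark at
  \<open>v\<close> may involve the marks of all other nodes, in particular those of the same generation.
\<close>
lemma nn_integral_mark_times_rest:
  assumes v: "v \<in> U" and f: "f \<in> borel_measurable S" and g: "g \<in> borel_measurable (rest v)"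
  shows "(\<integral>\<^sup>+\<omega>. f (X v \<omega>) * g \<omega> \<partial>M) = (\<integral>\<^sup>+\<omega>. f (X [] \<omega>) \<partial>M) * (\<integral>\<^sup>+\<omega>. g \<omega> \<partial>M)"
proof -
  define E where "E u = {X u -` B \<inter> space M |B. B \<in> sets S}" for u
  define I where "I = case_bool {v} (U - {v})"
  define F where "F = case_bool (\<lambda>\<omega>. f (X v \<omega>)) g"
  have I_Un: "(\<Union>b\<in>UNIV. I b) = U"
    using v by (auto simp: I_def UNIV_bool)
  have "indep_sets (\<lambda>b. sigma_sets (space M) (\<Union>u\<in>I b. E u)) UNIV"
  proof (rule indep_sets_collect_sigma)
    show "indep_sets E (\<Union>b\<in>UNIV. I b)"
      using indep_marks by (simp add: I_Un indep_vars_def2 E_def[abs_def])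
    show "Int_stable (E u)" for u
    proof (rule Int_stableI)
      fix A B assume "A \<in> E u" "B \<in> E u"
      then obtain A' B' where "A = X u -` A' \<inter> space M" "B = X u -` B' \<inter> space M"
        "A' \<in> sets S" "B' \<in> sets S" by (auto simp: E_def)
      then show "A \<inter> B \<in> E u" unfolding E_def by (auto intro!: exI[of _ "A' \<inter> B'"])
    qed
    show "disjoint_family_on I UNIV"
      by (auto simp: disjoint_family_on_def I_def split: bool.splits)
  qed
  moreover have "{F b -` B \<inter> space M |B. B \<in> sets borel} \<subseteq> sigma_sets (space M) (\<Union>u\<in>I b. E u)" for b
  proof (cases b)
    case True
    have "(\<lambda>\<omega>. f (X v \<omega>)) -` B \<inter> space M \<in> E v" if "B \<in> sets borel" for B
      unfolding E_def mem_Collect_eq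
    proof (intro exI conjI)
      show "f -` B \<inter> space S \<in> sets S"
        using f that by (rule measurable_sets)
      show "(\<lambda>\<omega>. f (X v \<omega>)) -` B \<inter> space M = X v -` (f -` B \<inter> space S) \<inter> space M"
        using measurable_space[OF measurable_mark[OF v]] by auto
    qed
    then show ?thesis using True
      by (auto simp: F_def I_def intro!: sigma_sets.Basic)
  next
    case False
    have "g -` B \<inter> space M \<in> sets (rest v)" if "B \<in> sets borel" for B
      using measurable_sets[OF g that] by (simp add: space_rest)
    with False show ?thesis by (auto simp: F_def I_def E_def sets_rest)
  qed
  ultimately have "indep_sets (\<lambda>b. {F b -` B \<inter> space M |B. B \<in> sets borel}) UNIV"
    by (rule indep_sets_mono_sets)
  moreover have "F b \<in> borel_measurable M" for b
    using measurable_compose[OF measurable_mark[OF v] f] measurable_restD[OF g]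
    by (cases b) (simp_all add: F_def)
  ultimately have "indep_vars (\<lambda>_. borel) F UNIV"
    by (simp add: indep_vars_def2)
  from indep_vars_nn_integral[OF _ this]
  have "(\<integral>\<^sup>+\<omega>. f (X v \<omega>) * g \<omega> \<partial>M) = (\<integral>\<^sup>+\<omega>. f (X v \<omega>) \<partial>M) * (\<integral>\<^sup>+\<omega>. g \<omega> \<partial>M)"
    by (simp add: UNIV_bool F_def mult.commute)
  then show ?thesis by (simp add: nn_integral_mark[OF v f])
qed

definition path_weight :: "nat list \<Rightarrow> 'a \<Rightarrow> ennreal" where
  "path_weight v \<omega> = (\<Prod>k<length v. c (v ! k) (X (take k v) \<omega>))"

definition level_sum :: "('m \<Rightarrow> ennreal) \<Rightarrow> nat \<Rightarrow> 'a \<Rightarrow> ennreal" where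
  "level_sum q n \<omega> = (\<integral>\<^sup>+v. path_weight v \<omega> * q (X v \<omega>) \<partial>count_space (level n))"

definition offspring_weight :: "real \<Rightarrow> 'm \<Rightarrow> ennreal" where
  "offspring_weight p m = (\<integral>\<^sup>+j. ennpowr (c j m) p \<partial>count_space {1..})"

lemma path_weight_Nil [simp]: "path_weight [] \<omega> = 1"
  by (simp add: path_weight_def)

lemma path_weight_snoc: "path_weight (v @ [j]) \<omega> = path_weight v \<omega> * c j (X v \<omega>)"
  by (simp add: path_weight_def nth_append)

text \<open>The weight of a node is determined by the marks of its proper ancestors, which are shorter than \<open>v\<close>.\<close>
lemma measurable_path_weight_rest:
  assumes "w \<in> U" "length w \<le> length v"
  shows "path_weight w \<in> borel_measurable (rest v)"
  unfolding path_weight_def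
proof (intro borel_measurable_prod_ennreal)
  fix k assume k: "k \<in> {..<length w}"
  then have "length (take k w) < length v" using assms by simp
  then have "X (take k w) \<in> measurable (rest v) S"
    using assms take_in_U by (intro measurable_mark_rest) auto
  moreover have "c (w ! k) \<in> borel_measurable S"
    using assms k by (intro measurable_child_weight) (auto simp: U_def)
  ultimately show "(\<lambda>\<omega>. c (w ! k) (X (take k w) \<omega>)) \<in> borel_measurable (rest v)"
    by (rule measurable_compose)
qed

lemma measurable_path_weight: "w \<in> U \<Longrightarrow> path_weight w \<in> borel_measurable M"
  using measurable_path_weight_rest[of w w] by (intro measurable_restD[of _ w]) simp

lemma measurable_level_sum:
  assumes q: "q \<in> borel_measurable S"
  shows "level_sum q n \<in> borel_measurable M"
  unfolding level_sum_def using measurable_compose[OF measurable_mark q]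
  by (intro borel_measurable_nn_integral_count_space)
     (auto simp: level_def intro!: borel_measurable_times_ennreal measurable_path_weight)

lemma measurable_offspring_weight: "offspring_weight p \<in> borel_measurable S"
  unfolding offspring_weight_def
  by (intro borel_measurable_nn_integral_count_space measurable_compose[OF measurable_child_weight])
     auto

lemma level_sum_Suc_1: "level_sum (\<lambda>_. 1) (Suc n) = level_sum (offspring_weight 1) n"
  by (auto simp: level_sum_def nn_integral_level_Suc path_weight_snoc nn_integral_cmult offspring_weight_def)

text \<open>
  Powers of path weights are path weights of the tree with powered child weights, so their expected sum
  multiplies by \<open>\<rho>\<^sub>p\<close> in every generation.
\<close>
lemma nn_integral_sum_powers_over_level:
  assumes p: "0 < p" and f: "f \<in> borel_measurable S"
  shows "(\<integral>\<^sup>+\<omega>. \<integral>\<^sup>+v. ennpowr (path_weight v \<omega>) p * f (X v \<omega>) \<partial>count_space (level n) \<partial>M)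
    = (\<integral>\<^sup>+\<omega>. offspring_weight p (X [] \<omega>) \<partial>M) ^ n * (\<integral>\<^sup>+\<omega>. f (X [] \<omega>) \<partial>M)"
  using f
proof (induction n arbitrary: f)
  case 0
  then show ?case by (simp add: nn_integral_count_space_finite)
next
  case (Suc n)
  let ?\<rho> = "\<integral>\<^sup>+\<omega>. offspring_weight p (X [] \<omega>) \<partial>M"
  let ?f = "\<integral>\<^sup>+\<omega>. f (X [] \<omega>) \<partial>M"
  have pw [measurable]: "(\<lambda>\<omega>. ennpowr (path_weight v \<omega>) p) \<in> borel_measurable M" if "v \<in> U" for v
    using measurable_path_weight[OF that] by measurable
  have fX [measurable]: "(\<lambda>\<omega>. f (X v \<omega>)) \<in> borel_measurable M" if "v \<in> U" for v
    using measurable_compose[OF measurable_mark[OF that] Suc.prems] .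
  have "(\<integral>\<^sup>+\<omega>. \<integral>\<^sup>+v. ennpowr (path_weight v \<omega>) p * f (X v \<omega>) \<partial>count_space (level (Suc n)) \<partial>M)
     = (\<integral>\<^sup>+v. \<integral>\<^sup>+\<omega>. f (X v \<omega>) * ennpowr (path_weight v \<omega>) p \<partial>M \<partial>count_space (level (Suc n)))"
    by (subst nn_integral_count_space_nn_integral) (auto simp: level_def mult.commute)
  also have "\<dots> = (\<integral>\<^sup>+v. ?f * (\<integral>\<^sup>+\<omega>. ennpowr (path_weight v \<omega>) p \<partial>M) \<partial>count_space (level (Suc n)))"
    using measurable_compose[OF measurable_path_weight_rest measurable_ennpowr]
    by (intro nn_integral_cong nn_integral_mark_times_rest Suc.prems) (auto simp: level_def)
  also have "\<dots> = ?f * (\<integral>\<^sup>+\<omega>. \<integral>\<^sup>+v. ennpowr (path_weight v \<omega>) p \<partial>count_space (level (Suc n)) \<partial>M)"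
    by (subst nn_integral_count_space_nn_integral) (auto simp: level_def nn_integral_cmult)
  also have "(\<integral>\<^sup>+\<omega>. \<integral>\<^sup>+v. ennpowr (path_weight v \<omega>) p \<partial>count_space (level (Suc n)) \<partial>M)
      = (\<integral>\<^sup>+\<omega>. \<integral>\<^sup>+v. ennpowr (path_weight v \<omega>) p * offspring_weight p (X v \<omega>) \<partial>count_space (level n) \<partial>M)"
    using p by (simp add: nn_integral_level_Suc path_weight_snoc ennpowr_mult nn_integral_cmult offspring_weight_def)
  also have "\<dots> = ?\<rho> ^ n * ?\<rho>"
    by (rule Suc.IH) (rule measurable_offspring_weight)
  finally show ?case by (simp add: mult_ac)
qed

lemma level_sum_moment_le_one:
  assumes p: "0 < p" "p \<le> 1" and q[measurable]: "q \<in> borel_measurable S"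
  shows "(\<integral>\<^sup>+\<omega>. ennpowr (level_sum q n \<omega>) p \<partial>M)
    \<le> (\<integral>\<^sup>+\<omega>. offspring_weight p (X [] \<omega>) \<partial>M) ^ n * (\<integral>\<^sup>+\<omega>. ennpowr (q (X [] \<omega>)) p \<partial>M)"
proof -
  have "(\<integral>\<^sup>+\<omega>. ennpowr (level_sum q n \<omega>) p \<partial>M)
    \<le> (\<integral>\<^sup>+\<omega>. \<integral>\<^sup>+v. ennpowr (path_weight v \<omega>) p * ennpowr (q (X v \<omega>)) p \<partial>count_space (level n) \<partial>M)"
    unfolding level_sum_def ennpowr_mult[OF p(1), symmetric]
    by (intro nn_integral_mono ennpowr_subadditive p)
  also have "\<dots> = (\<integral>\<^sup>+\<omega>. offspring_weight p (X [] \<omega>) \<partial>M) ^ n * (\<integral>\<^sup>+\<omega>. ennpowr (q (X [] \<omega>)) p \<partial>M)"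
    using p by (intro nn_integral_sum_powers_over_level) auto
  finally show ?thesis .
qed

text \<open>
  Jensen's inequality leaves the factor \<open>Z ^ (p - 1) * path_weight v\<close> in front of \<open>q ^ p\<close> at \<open>v\<close>; it only
  depends on earlier generations, so the expectation factorizes, and the factors sum up to \<open>Z ^ p\<close>.
\<close>
lemma level_sum_moment_Jensen:
  assumes p: "1 < p" and q[measurable]: "q \<in> borel_measurable S"
  shows "(\<integral>\<^sup>+\<omega>. ennpowr (level_sum q n \<omega>) p \<partial>M)
    \<le> (\<integral>\<^sup>+\<omega>. ennpowr (level_sum (\<lambda>_. 1) n \<omega>) p \<partial>M) * (\<integral>\<^sup>+\<omega>. ennpowr (q (X [] \<omega>)) p \<partial>M)"
proof -
  let ?Z = "level_sum (\<lambda>_. 1) n"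
  let ?q = "\<integral>\<^sup>+\<omega>. ennpowr (q (X [] \<omega>)) p \<partial>M"
  have Z_rest: "?Z \<in> borel_measurable (rest v)" if "v \<in> level n" for v
    unfolding level_sum_def using that
    by (intro borel_measurable_nn_integral_count_space borel_measurable_times_ennreal measurable_path_weight_rest)
       (auto simp: level_def)
  have g_rest: "(\<lambda>\<omega>. ennpowr (?Z \<omega>) (p - 1) * path_weight v \<omega>) \<in> borel_measurable (rest v)"
    if "v \<in> level n" for v
    using that by (intro borel_measurable_times_ennreal measurable_path_weight_rest
        measurable_compose[OF Z_rest measurable_ennpowr]) (auto simp: level_def)
  have [measurable]: "(\<lambda>\<omega>. ennpowr (q (X v \<omega>)) p) \<in> borel_measurable M"
    "path_weight v \<in> borel_measurable M" if "v \<in> level n" for v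
    using measurable_compose[OF measurable_mark q] that 
    by (auto simp: level_def intro: measurable_compose[OF _ measurable_ennpowr] measurable_path_weight)
  note [measurable] = measurable_level_sum[of "\<lambda>_. 1" n, simplified]
  have "(\<integral>\<^sup>+\<omega>. ennpowr (level_sum q n \<omega>) p \<partial>M)
    \<le> (\<integral>\<^sup>+\<omega>. ennpowr (?Z \<omega>) (p - 1)
         * (\<integral>\<^sup>+v. path_weight v \<omega> * ennpowr (q (X v \<omega>)) p \<partial>count_space (level n)) \<partial>M)"
    using ennpowr_weighted_sum_Jensen[OF p] by (intro nn_integral_mono) (simp add: level_sum_def)
  also have "\<dots> = (\<integral>\<^sup>+\<omega>. \<integral>\<^sup>+v. ennpowr (q (X v \<omega>)) p * (ennpowr (?Z \<omega>) (p - 1) * path_weight v \<omega>)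
       \<partial>count_space (level n) \<partial>M)"
    by (simp add: nn_integral_cmult[symmetric] mult_ac)
  also have "\<dots> = (\<integral>\<^sup>+v. \<integral>\<^sup>+\<omega>. ennpowr (q (X v \<omega>)) p * (ennpowr (?Z \<omega>) (p - 1) * path_weight v \<omega>)
       \<partial>M \<partial>count_space (level n))"
    by (subst nn_integral_count_space_nn_integral) auto
  also have "\<dots> = (\<integral>\<^sup>+v. ?q * (\<integral>\<^sup>+\<omega>. ennpowr (?Z \<omega>) (p - 1) * path_weight v \<omega> \<partial>M) \<partial>count_space (level n))"
    using g_rest by (intro nn_integral_cong nn_integral_mark_times_rest) (auto simp: level_def)
  also have "\<dots> = ?q * (\<integral>\<^sup>+\<omega>. \<integral>\<^sup>+v. ennpowr (?Z \<omega>) (p - 1) * path_weight v \<omega> \<partial>count_space (level n) \<partial>M)"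
    by (subst nn_integral_count_space_nn_integral) (auto simp: nn_integral_cmult)
  also have "(\<lambda>\<omega>. \<integral>\<^sup>+v. ennpowr (?Z \<omega>) (p - 1) * path_weight v \<omega> \<partial>count_space (level n))
      = (\<lambda>\<omega>. ennpowr (?Z \<omega>) p)"
    using mult_ennpowr[OF p]
    by (simp add: nn_integral_multc level_sum_def mult.commute)
  finally show ?thesis by (simp add: mult.commute)
qed

text \<open>
  A Rosenthal type inequality: the \<open>p\<close>-th moment is controlled by the individual terms, at the price of
  a large constant, and by the mean, with a constant close to 1.  Finiteness of the left-hand side is
  essential to the argument, since Young's inequality bounds it by the
  other terms plus a fraction of itself.
\<close>
lemma level_sum_moment_largest_or_mean:
  assumes p: "1 < p" and d: "1 < (d::real)"
  obtains K :: real where "0 \<le> K"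
    "\<And>q n. q \<in> borel_measurable S \<Longrightarrow> (\<integral>\<^sup>+\<omega>. ennpowr (level_sum q n \<omega>) p \<partial>M) < \<top> \<Longrightarrow>
      (\<integral>\<^sup>+\<omega>. ennpowr (level_sum q n \<omega>) p \<partial>M)
      \<le> ennreal K * (\<integral>\<^sup>+\<omega>. offspring_weight p (X [] \<omega>) \<partial>M) ^ n * (\<integral>\<^sup>+\<omega>. ennpowr (q (X [] \<omega>)) p \<partial>M)
        + ennpowr (ennreal d * (\<integral>\<^sup>+\<omega>. q (X [] \<omega>) \<partial>M)) p * (\<integral>\<^sup>+\<omega>. ennpowr (level_sum (\<lambda>_. 1) n \<omega>) p \<partial>M)"
proof -
  obtain K where K: "0 \<le> K"
    "\<And>x y. ennpowr (x + y) (p - 1) \<le> ennreal K * ennpowr x (p - 1) + ennreal d * ennpowr y (p - 1)"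
    using ennpowr_add_le[of "p - 1" d] p d by auto
  have "(\<integral>\<^sup>+\<omega>. ennpowr (level_sum q n \<omega>) p \<partial>M)
      \<le> ennreal (p * K) * (\<integral>\<^sup>+\<omega>. offspring_weight p (X [] \<omega>) \<partial>M) ^ n * (\<integral>\<^sup>+\<omega>. ennpowr (q (X [] \<omega>)) p \<partial>M)
        + ennpowr (ennreal d * (\<integral>\<^sup>+\<omega>. q (X [] \<omega>) \<partial>M)) p * (\<integral>\<^sup>+\<omega>. ennpowr (level_sum (\<lambda>_. 1) n \<omega>) p \<partial>M)"
    if q[measurable]: "q \<in> borel_measurable S" and fin: "(\<integral>\<^sup>+\<omega>. ennpowr (level_sum q n \<omega>) p \<partial>M) < \<top>" for q n
  proof -
    define m where "m = (\<integral>\<^sup>+\<omega>. q (X [] \<omega>) \<partial>M)"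
    define \<rho> where "\<rho> = (\<integral>\<^sup>+\<omega>. offspring_weight p (X [] \<omega>) \<partial>M)"
    define mp where "mp = (\<integral>\<^sup>+\<omega>. ennpowr (q (X [] \<omega>)) p \<partial>M)"
    let ?Z = "level_sum (\<lambda>_. 1) n" and ?S = "level_sum q n"
    \<comment> \<open>\<open>T v\<close> is the sum without its term \<open>x v\<close>, and hence does not depend on the mark at \<open>v\<close>.\<close>
    define x where "x v \<omega> = path_weight v \<omega> * q (X v \<omega>)" for v \<omega>
    define T where "T v \<omega> = (\<integral>\<^sup>+u. x u \<omega> * indicator (- {v}) u \<partial>count_space (level n))" for v \<omega>
    have S_split: "?S \<omega> = x v \<omega> + T v \<omega>" if "v \<in> level n" for v \<omega>
    proof -
      have "?S \<omega> = (\<integral>\<^sup>+u. x u \<omega> * indicator {v} u + x u \<omega> * indicator (- {v}) u \<partial>count_space (level n))"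
        unfolding level_sum_def x_def by (intro nn_integral_cong) (auto split: split_indicator)
      also have "\<dots> = x v \<omega> + T v \<omega>"
        using that by (simp add: nn_integral_add T_def)
      finally show ?thesis .
    qed
    have S_meas[measurable]: "?S \<in> borel_measurable M" and Z_meas[measurable]: "?Z \<in> borel_measurable M"
      by (auto intro: measurable_level_sum)
    have qX[measurable]: "(\<lambda>\<omega>. q (X v \<omega>)) \<in> borel_measurable M"
      and pw[measurable]: "path_weight v \<in> borel_measurable M"
      and x_meas[measurable]: "x v \<in> borel_measurable M" if "v \<in> level n" for v
      unfolding x_def[abs_def] using measurable_compose[OF measurable_mark q] that
      by (auto simp: level_def intro!: borel_measurable_times_ennreal measurable_path_weight)
    have T_rest: "T v \<in> borel_measurable (rest v)" if "v \<in> level n" for v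
      unfolding T_def
    proof (intro borel_measurable_nn_integral_count_space)
      fix u assume u: "u \<in> level n"
      show "(\<lambda>\<omega>. x u \<omega> * indicator (- {v}) u) \<in> borel_measurable (rest v)"
      proof (cases "u = v")
        case False
        with u that show ?thesis
          unfolding x_def using measurable_compose[OF measurable_mark_rest q, of u v]
          by (intro borel_measurable_times_ennreal measurable_path_weight_rest) (auto simp: level_def)
      qed simp
    qed simp
    have pT_rest: "(\<lambda>\<omega>. path_weight v \<omega> * ennpowr (T v \<omega>) (p - 1)) \<in> borel_measurable (rest v)"
      if "v \<in> level n" for v
      using that by (intro borel_measurable_times_ennreal measurable_path_weight_rest
          measurable_compose[OF T_rest measurable_ennpowr]) (auto simp: level_def)
    note [measurable] = measurable_restD[OF T_rest]
    have pointwise: "ennpowr (?S \<omega>) p \<le> (\<integral>\<^sup>+v. ennreal K * (ennpowr (path_weight v \<omega>) p * ennpowr (q (X v \<omega>)) p)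
       + ennreal d * (q (X v \<omega>) * (path_weight v \<omega> * ennpowr (T v \<omega>) (p - 1))) \<partial>count_space (level n))" for \<omega>
    proof -
      have "ennpowr (?S \<omega>) p = ?S \<omega> * ennpowr (?S \<omega>) (p - 1)"
        by (simp add: mult_ennpowr p)
      also have "\<dots> = (\<integral>\<^sup>+v. x v \<omega> * ennpowr (?S \<omega>) (p - 1) \<partial>count_space (level n))"
        by (simp add: nn_integral_multc level_sum_def x_def)
      also have "\<dots> \<le> (\<integral>\<^sup>+v. x v \<omega> * (ennreal K * ennpowr (x v \<omega>) (p - 1) + ennreal d * ennpowr (T v \<omega>) (p - 1))
           \<partial>count_space (level n))"
        using K(2) by (intro nn_integral_mono mult_left_mono) (auto simp: S_split)
      also have "\<dots> = (\<integral>\<^sup>+v. ennreal K * (x v \<omega> * ennpowr (x v \<omega>) (p - 1)) + ennreal d * (x v \<omega> * ennpowr (T v \<omega>) (p - 1))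
           \<partial>count_space (level n))"
        by (simp add: distrib_left mult_ac)
      also have "\<dots> = (\<integral>\<^sup>+v. ennreal K * (ennpowr (path_weight v \<omega>) p * ennpowr (q (X v \<omega>)) p)
       + ennreal d * (q (X v \<omega>) * (path_weight v \<omega> * ennpowr (T v \<omega>) (p - 1))) \<partial>count_space (level n))"
        unfolding mult_ennpowr[OF p] using p by (simp add: x_def ennpowr_mult mult_ac)
      finally show ?thesis .
    qed
    \<comment> \<open>Independence applies with \<open>T v\<close> in place of the full sum, which is restored afterwards.\<close>
    have cross: "(\<integral>\<^sup>+v. \<integral>\<^sup>+\<omega>. q (X v \<omega>) * (path_weight v \<omega> * ennpowr (T v \<omega>) (p - 1)) \<partial>M \<partial>count_space (level n))
      \<le> m * (\<integral>\<^sup>+\<omega>. ?Z \<omega> * ennpowr (?S \<omega>) (p - 1) \<partial>M)"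
    proof -
      have "(\<integral>\<^sup>+v. \<integral>\<^sup>+\<omega>. q (X v \<omega>) * (path_weight v \<omega> * ennpowr (T v \<omega>) (p - 1)) \<partial>M \<partial>count_space (level n))
        = (\<integral>\<^sup>+v. m * (\<integral>\<^sup>+\<omega>. path_weight v \<omega> * ennpowr (T v \<omega>) (p - 1) \<partial>M) \<partial>count_space (level n))"
        unfolding m_def using pT_rest
        by (intro nn_integral_cong nn_integral_mark_times_rest) (auto simp: level_def)
      also have "\<dots> \<le> (\<integral>\<^sup>+v. m * (\<integral>\<^sup>+\<omega>. path_weight v \<omega> * ennpowr (?S \<omega>) (p - 1) \<partial>M) \<partial>count_space (level n))"
        using p by (intro nn_integral_mono mult_left_mono ennpowr_mono) (auto simp: S_split)
      also have "\<dots> = m * (\<integral>\<^sup>+\<omega>. \<integral>\<^sup>+v. path_weight v \<omega> * ennpowr (?S \<omega>) (p - 1) \<partial>count_space (level n) \<partial>M)"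
        by (subst nn_integral_count_space_nn_integral) (auto simp: nn_integral_cmult)
      also have "\<dots> = m * (\<integral>\<^sup>+\<omega>. ?Z \<omega> * ennpowr (?S \<omega>) (p - 1) \<partial>M)"
        by (simp add: nn_integral_multc level_sum_def)
      finally show ?thesis .
    qed
    define s where "s = (\<integral>\<^sup>+\<omega>. ennpowr (?S \<omega>) p \<partial>M)"
    define z where "z = (\<integral>\<^sup>+\<omega>. ennpowr (?Z \<omega>) p \<partial>M)"
    have Young: "ennreal p * (ennreal d * (m * (\<integral>\<^sup>+\<omega>. ?Z \<omega> * ennpowr (?S \<omega>) (p - 1) \<partial>M)))
      \<le> ennpowr (ennreal d * m) p * z + ennreal (p - 1) * s"
    proof -
      have "ennreal p * (ennreal d * (m * (\<integral>\<^sup>+\<omega>. ?Z \<omega> * ennpowr (?S \<omega>) (p - 1) \<partial>M)))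
        = (\<integral>\<^sup>+\<omega>. ennreal p * (ennreal d * m * ?Z \<omega>) * ennpowr (?S \<omega>) (p - 1) \<partial>M)"
        by (simp add: nn_integral_cmult[symmetric] mult_ac)
      also have "\<dots> \<le> (\<integral>\<^sup>+\<omega>. ennpowr (ennreal d * m * ?Z \<omega>) p + ennreal (p - 1) * ennpowr (?S \<omega>) p \<partial>M)"
        by (intro nn_integral_mono ennpowr_Young p)
      also have "\<dots> = ennpowr (ennreal d * m) p * z + ennreal (p - 1) * s"
        using p by (simp add: ennpowr_mult[of _ _ "?Z _"] nn_integral_add nn_integral_cmult s_def z_def)
      finally show ?thesis .
    qed
    have main: "s \<le> ennreal K * (\<rho> ^ n * mp) + ennreal d * (m * (\<integral>\<^sup>+\<omega>. ?Z \<omega> * ennpowr (?S \<omega>) (p - 1) \<partial>M))"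
    proof -
      have "s \<le> (\<integral>\<^sup>+\<omega>. \<integral>\<^sup>+v. ennreal K * (ennpowr (path_weight v \<omega>) p * ennpowr (q (X v \<omega>)) p)
       + ennreal d * (q (X v \<omega>) * (path_weight v \<omega> * ennpowr (T v \<omega>) (p - 1))) \<partial>count_space (level n) \<partial>M)"
        unfolding s_def by (intro nn_integral_mono pointwise)
      also have "\<dots> = (\<integral>\<^sup>+v. \<integral>\<^sup>+\<omega>. ennreal K * (ennpowr (path_weight v \<omega>) p * ennpowr (q (X v \<omega>)) p)
       + ennreal d * (q (X v \<omega>) * (path_weight v \<omega> * ennpowr (T v \<omega>) (p - 1))) \<partial>M \<partial>count_space (level n))"
        by (subst nn_integral_count_space_nn_integral) auto
      also have "\<dots> = ennreal K * (\<integral>\<^sup>+v. \<integral>\<^sup>+\<omega>. ennpowr (path_weight v \<omega>) p * ennpowr (q (X v \<omega>)) p \<partial>M \<partial>count_space (level n))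
       + ennreal d * (\<integral>\<^sup>+v. \<integral>\<^sup>+\<omega>. q (X v \<omega>) * (path_weight v \<omega> * ennpowr (T v \<omega>) (p - 1)) \<partial>M \<partial>count_space (level n))"
        by (simp add: nn_integral_add nn_integral_cmult cong: nn_integral_cong_simp)
      also have "(\<integral>\<^sup>+v. \<integral>\<^sup>+\<omega>. ennpowr (path_weight v \<omega>) p * ennpowr (q (X v \<omega>)) p \<partial>M \<partial>count_space (level n)) = \<rho> ^ n * mp"
        unfolding \<rho>_def mp_def using p nn_integral_sum_powers_over_level[of p "\<lambda>m. ennpowr (q m) p" n]
        by (subst nn_integral_count_space_nn_integral[symmetric]) auto
      finally show ?thesis using cross by (auto elim!: order_trans intro!: add_left_mono mult_left_mono)
    qed
    have s_fin: "s < \<top>" using fin by (simp add: s_def)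
    \<comment> \<open>Young's inequality returns \<open>p - 1\<close> copies of \<open>s\<close>; cancelling them needs \<open>s\<close> to be finite.\<close>
    have "ennreal (p - 1) + 1 = ennreal p"
      using p by (simp add: ennreal_plus[symmetric] ennreal_1[symmetric] del: ennreal_plus ennreal_1)
    then have "ennreal (p - 1) * s + s = ennreal p * s"
      using distrib_right[of "ennreal (p - 1)" 1 s] by simp
    also have "\<dots> \<le> ennreal p * (ennreal K * (\<rho> ^ n * mp)) + (ennpowr (ennreal d * m) p * z + ennreal (p - 1) * s)"
      using mult_left_mono[OF main, of "ennreal p"] Young
      by (auto simp: distrib_left elim!: order_trans intro!: add_left_mono)
    finally have "ennreal (p - 1) * s + s
      \<le> ennreal (p - 1) * s + (ennreal p * (ennreal K * (\<rho> ^ n * mp)) + ennpowr (ennreal d * m) p * z)"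
      by (simp add: add_ac)
    then have "s \<le> ennreal p * (ennreal K * (\<rho> ^ n * mp)) + ennpowr (ennreal d * m) p * z"
      using s_fin by (subst (asm) ennreal_add_left_cancel_le) (auto simp: ennreal_mult_eq_top_iff)
    then show ?thesis
      unfolding s_def z_def m_def \<rho>_def mp_def using p K(1) by (simp add: ennreal_mult mult_ac)
  qed
  with that[of "p * K"] K(1) p show thesis by simp
qed

end

section \<open>Geometric decay and summation over generations\<close>

lemma moment_suminf_finite_le_one:
  fixes f :: "nat \<Rightarrow> 'b \<Rightarrow> ennreal"
  assumes p: "0 < p" "p \<le> 1" and f[measurable]: "\<And>n. f n \<in> borel_measurable N"
    and le: "\<And>n. (\<integral>\<^sup>+x. ennpowr (f n x) p \<partial>N) \<le> ennreal (D * \<eta> ^ n)"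
    and D: "0 \<le> D" and \<eta>: "0 \<le> \<eta>" "\<eta> < 1"
  shows "(\<integral>\<^sup>+x. ennpowr (\<Sum>n. f n x) p \<partial>N) < \<top>"
proof -
  have "(\<integral>\<^sup>+x. ennpowr (\<Sum>n. f n x) p \<partial>N) \<le> (\<integral>\<^sup>+x. (\<Sum>n. ennpowr (f n x) p) \<partial>N)"
    using ennpowr_subadditive[OF p, where I = "UNIV :: nat set"]
    by (intro nn_integral_mono) (simp add: nn_integral_count_space_nat)
  also have "\<dots> = (\<Sum>n. \<integral>\<^sup>+x. ennpowr (f n x) p \<partial>N)"
    by (rule nn_integral_suminf) measurable
  also have "\<dots> \<le> (\<Sum>n. ennreal (D * \<eta> ^ n))"
    by (intro suminf_le le) auto
  also have "\<dots> < \<top>"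
    using D \<eta> by (simp add: less_top[symmetric] ennreal_suminf_neq_top summable_mult summable_geometric)
  finally show ?thesis .
qed

text \<open>
  Jensen's inequality with weights \<open>r ^ n\<close> costs a factor \<open>r powr (1 - p)\<close> per step, which must not eat
  up the decay rate \<open>\<eta>\<close>.
\<close>
lemma moment_suminf_finite_gt_one:
  fixes f :: "nat \<Rightarrow> 'b \<Rightarrow> ennreal"
  assumes p: "1 < p" and f[measurable]: "\<And>n. f n \<in> borel_measurable N"
    and le: "\<And>n. (\<integral>\<^sup>+x. ennpowr (f n x) p \<partial>N) \<le> ennreal (D * \<eta> ^ n)"
    and D: "0 \<le> D" and \<eta>: "0 < \<eta>" "\<eta> < 1"
  shows "(\<integral>\<^sup>+x. ennpowr (\<Sum>n. f n x) p \<partial>N) < \<top>"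
proof -
  \<comment> \<open>With this \<open>r\<close> the factor per step is \<open>1 / sqrt \<eta>\<close>, so the series still decays like \<open>sqrt \<eta> ^ n\<close>.\<close>
  define r where "r = \<eta> powr (1 / (2 * (p - 1)))"
  have r: "0 < r" "r < 1"
    using p \<eta> powr_less_mono2[of "1 / (2 * (p - 1))" \<eta> 1] by (auto simp: r_def)
  define b where "b = r * (1 / r) powr p"
  have b0: "0 \<le> b" using r by (simp add: b_def)
  have "b = 1 / r powr (p - 1)"
    using r by (simp add: b_def powr_divide powr_diff)
  also have "r powr (p - 1) = \<eta> powr (1 / 2)"
  proof -
    have "1 / (2 * (p - 1)) * (p - 1) = 1 / 2" using p by (simp add: field_simps)
    then show ?thesis by (simp only: r_def powr_powr)
  qed
  also have "1 / \<eta> powr (1/2) * \<eta> = \<eta> powr (1 / 2)"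
    using \<eta> powr_add[of \<eta> "1/2" "1/2"] by (simp add: field_simps)
  finally have b_lt: "b * \<eta> < 1"
    using powr_less_mono2[of "1/2" \<eta> 1] \<eta> by simp
  define A where "A = (\<Sum>n. ennreal (r ^ n))"
  have A: "A < \<top>"
    using r by (simp add: A_def less_top[symmetric] ennreal_suminf_neq_top summable_geometric)
  have "(\<integral>\<^sup>+x. ennpowr (\<Sum>n. f n x) p \<partial>N)
     \<le> (\<integral>\<^sup>+x. ennpowr A (p - 1) * (\<Sum>n. ennreal (b ^ n) * ennpowr (f n x) p) \<partial>N)"
  proof (intro nn_integral_mono)
    fix x
    have "(\<Sum>n. f n x) = (\<Sum>n. ennreal (r ^ n) * (ennreal ((1 / r) ^ n) * f n x))"
    proof (intro suminf_cong)
      fix n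
      have "ennreal (r ^ n) * (ennreal ((1 / r) ^ n) * f n x) = ennreal (r ^ n * (1 / r) ^ n) * f n x"
        using r by (simp add: ennreal_mult mult.assoc)
      also have "r ^ n * (1 / r) ^ n = 1"
        using r by (simp add: power_mult_distrib[symmetric])
      finally show "f n x = ennreal (r ^ n) * (ennreal ((1 / r) ^ n) * f n x)" by simp
    qed
    then have "ennpowr (\<Sum>n. f n x) p
        \<le> ennpowr A (p - 1) * (\<Sum>n. ennreal (r ^ n) * ennpowr (ennreal ((1 / r) ^ n) * f n x) p)"
      using ennpowr_weighted_sum_Jensen[OF p, where I = UNIV and a = "\<lambda>n. ennreal (r ^ n)" and y = "\<lambda>n. ennreal ((1 / r) ^ n) * f n x"]
      by (simp add: nn_integral_count_space_nat A_def)
    also have "(\<Sum>n. ennreal (r ^ n) * ennpowr (ennreal ((1 / r) ^ n) * f n x) p)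
        = (\<Sum>n. ennreal (b ^ n) * ennpowr (f n x) p)"
    proof (intro suminf_cong)
      fix n
      have "((1 / r) ^ n) powr p = ((1 / r) powr p) ^ n"
        using r by (simp add: powr_power powr_powr powr_realpow[symmetric] mult.commute del: power_divide)
      then show "ennreal (r ^ n) * ennpowr (ennreal ((1 / r) ^ n) * f n x) p = ennreal (b ^ n) * ennpowr (f n x) p"
        using r p by (simp add: ennpowr_mult ennpowr_ennreal b_def power_mult_distrib ennreal_mult mult.assoc)
    qed
    finally show "ennpowr (\<Sum>n. f n x) p \<le> ennpowr A (p - 1) * (\<Sum>n. ennreal (b ^ n) * ennpowr (f n x) p)" .
  qed
  also have "\<dots> = ennpowr A (p - 1) * (\<Sum>n. ennreal (b ^ n) * (\<integral>\<^sup>+x. ennpowr (f n x) p \<partial>N))"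
    by (simp add: nn_integral_cmult nn_integral_suminf)
  also have "\<dots> \<le> ennpowr A (p - 1) * (\<Sum>n. ennreal (b ^ n) * ennreal (D * \<eta> ^ n))"
    by (intro mult_left_mono suminf_le le) auto
  also have "\<dots> = ennpowr A (p - 1) * (\<Sum>n. ennreal (D * (b * \<eta>) ^ n))"
    using b0 D \<eta> by (simp add: ennreal_mult[symmetric] power_mult_distrib mult_ac)
  also have "\<dots> < \<top>"
    using A b0 b_lt D \<eta> by (auto simp: less_top[symmetric] ennreal_mult_eq_top_iff ennreal_suminf_neq_top
        summable_mult summable_geometric)
  finally show ?thesis .
qed

context weighted_branching_tree begin

text \<open>
  The recursion \<open>z (n + 1) \<le> K * y * r ^ n + \<theta> * z n\<close> with \<open>r < 1\<close> and \<open>\<theta> < 1\<close>, solved by \<open>D * \<eta> ^ n\<close> for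
  any \<open>\<eta>\<close> strictly between \<open>max r \<theta>\<close> and 1.  The induction also supplies, through Jensen's inequality,
  the finiteness on which the recursion rests.
\<close>
lemma level_weight_moment_geometric:
  assumes p: "1 < p"
    and mean: "(\<integral>\<^sup>+\<omega>. offspring_weight 1 (X [] \<omega>) \<partial>M) < 1"
    and powr: "(\<integral>\<^sup>+\<omega>. offspring_weight p (X [] \<omega>) \<partial>M) < 1"
    and moment: "(\<integral>\<^sup>+\<omega>. ennpowr (offspring_weight 1 (X [] \<omega>)) p \<partial>M) < \<top>"
  obtains D \<eta> :: real where "0 \<le> D" "0 < \<eta>" "\<eta> < 1"
    "\<And>n. (\<integral>\<^sup>+\<omega>. ennpowr (level_sum (\<lambda>_. 1) n \<omega>) p \<partial>M) \<le> ennreal (D * \<eta> ^ n)"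
proof -
  let ?z = "\<lambda>n. \<integral>\<^sup>+\<omega>. ennpowr (level_sum (\<lambda>_. 1) n \<omega>) p \<partial>M"
  obtain m where m: "(\<integral>\<^sup>+\<omega>. offspring_weight 1 (X [] \<omega>) \<partial>M) = ennreal m" "0 \<le> m" "m < 1"
    using mean by (cases "\<integral>\<^sup>+\<omega>. offspring_weight 1 (X [] \<omega>) \<partial>M") auto
  obtain r where r: "(\<integral>\<^sup>+\<omega>. offspring_weight p (X [] \<omega>) \<partial>M) = ennreal r" "0 \<le> r" "r < 1"
    using powr by (cases "\<integral>\<^sup>+\<omega>. offspring_weight p (X [] \<omega>) \<partial>M") auto
  obtain y where y: "(\<integral>\<^sup>+\<omega>. ennpowr (offspring_weight 1 (X [] \<omega>)) p \<partial>M) = ennreal y" "0 \<le> y"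
    using moment by (cases "\<integral>\<^sup>+\<omega>. ennpowr (offspring_weight 1 (X [] \<omega>)) p \<partial>M") auto
  \<comment> \<open>A choice with \<open>d > 1\<close> and \<open>d * m < 1\<close> that also covers \<open>m = 0\<close>.\<close>
  define d where "d = 2 / (1 + m)"
  have d: "1 < d" "0 \<le> d * m" "d * m < 1" using m by (auto simp: d_def field_simps)
  define \<theta> where "\<theta> = (d * m) powr p"
  have \<theta>: "0 \<le> \<theta>" "\<theta> < 1"
    using d p powr_less_mono2[of p "d * m" 1] by (auto simp: \<theta>_def)
  obtain K where K: "0 \<le> K" and split:
    "\<And>q n. q \<in> borel_measurable S \<Longrightarrow> (\<integral>\<^sup>+\<omega>. ennpowr (level_sum q n \<omega>) p \<partial>M) < \<top> \<Longrightarrow>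
      (\<integral>\<^sup>+\<omega>. ennpowr (level_sum q n \<omega>) p \<partial>M)
      \<le> ennreal K * (\<integral>\<^sup>+\<omega>. offspring_weight p (X [] \<omega>) \<partial>M) ^ n * (\<integral>\<^sup>+\<omega>. ennpowr (q (X [] \<omega>)) p \<partial>M)
        + ennpowr (ennreal d * (\<integral>\<^sup>+\<omega>. q (X [] \<omega>) \<partial>M)) p * ?z n"
    using level_sum_moment_largest_or_mean[OF p d(1)] by metis
  define \<eta> where "\<eta> = (1 + max r \<theta>) / 2"
  define D where "D = max 1 (K * y / (\<eta> - \<theta>))"
  have \<eta>: "0 < \<eta>" "\<eta> < 1" "r \<le> \<eta>" "\<theta> < \<eta>"
    using r \<theta> by (auto simp: \<eta>_def max_def)
  have D: "0 \<le> D" "K * y \<le> D * (\<eta> - \<theta>)"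
    using \<eta> by (auto simp: D_def max_def field_simps)
  have bound: "?z n \<le> ennreal (D * \<eta> ^ n)" for n
  proof (induction n)
    case 0
    have "?z 0 = 1"
      by (simp add: level_sum_def nn_integral_count_space_finite emeasure_space_1)
    also have "\<dots> \<le> ennreal D"
      by (simp add: D_def ennreal_1[symmetric] del: ennreal_1)
    finally show ?case by simp
  next
    case (Suc n)
    note Y = measurable_offspring_weight[of 1]
    have "?z (Suc n) \<le> ?z n * ennreal y"
      using level_sum_moment_Jensen[OF p Y] by (simp add: level_sum_Suc_1 y)
    also have "\<dots> < \<top>"
      using le_less_trans[OF Suc.IH ennreal_less_top] by (simp add: ennreal_mult_less_top)
    finally have "?z (Suc n) < \<top>" .
    then have "?z (Suc n) \<le> ennreal K * ennreal r ^ n * ennreal y + ennpowr (ennreal d * ennreal m) p * ?z n"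
      using split[OF Y, of n] by (simp add: level_sum_Suc_1 y r(1) m(1))
    also have "\<dots> \<le> ennreal K * ennreal r ^ n * ennreal y
        + ennpowr (ennreal d * ennreal m) p * ennreal (D * \<eta> ^ n)"
      by (intro add_left_mono mult_left_mono Suc.IH) simp
    also have "\<dots> = ennreal (K * r ^ n * y + \<theta> * (D * \<eta> ^ n))"
      using K r m y d D \<eta> \<theta>
      by (simp add: ennreal_mult[symmetric] ennreal_power ennpowr_ennreal \<theta>_def ennreal_plus[symmetric] del: ennreal_plus)
    also have "K * r ^ n * y + \<theta> * (D * \<eta> ^ n) \<le> K * y * \<eta> ^ n + \<theta> * (D * \<eta> ^ n)"
      using K r y \<eta> mult_left_mono[OF power_mono[of r \<eta> n], of "K * y"] by (simp add: mult_ac)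
    also have "\<dots> \<le> D * (\<eta> - \<theta>) * \<eta> ^ n + \<theta> * (D * \<eta> ^ n)"
      using D \<eta> by (intro add_right_mono mult_right_mono) auto
    also have "\<dots> = D * \<eta> ^ Suc n" by (simp add: algebra_simps)
    finally show ?case by (simp add: ennreal_leI)
  qed
  show thesis using that D(1) \<eta>(1,2) bound by blast
qed

lemma total_moment_finite:
  assumes p: "0 < p" and q: "q \<in> borel_measurable S"
    and moment: "(\<integral>\<^sup>+\<omega>. ennpowr (q (X [] \<omega>)) p \<partial>M) < \<top>"
    and powr: "(\<integral>\<^sup>+\<omega>. offspring_weight p (X [] \<omega>) \<partial>M) < 1"
    and gt_one: "1 < p \<Longrightarrow> (\<integral>\<^sup>+\<omega>. offspring_weight 1 (X [] \<omega>) \<partial>M) < 1"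
      "1 < p \<Longrightarrow> (\<integral>\<^sup>+\<omega>. ennpowr (offspring_weight 1 (X [] \<omega>)) p \<partial>M) < \<top>"
  shows "(\<integral>\<^sup>+\<omega>. ennpowr (\<Sum>n. level_sum q n \<omega>) p \<partial>M) < \<top>"
proof -
  obtain k where k: "(\<integral>\<^sup>+\<omega>. ennpowr (q (X [] \<omega>)) p \<partial>M) = ennreal k" "0 \<le> k"
    using moment by (cases "\<integral>\<^sup>+\<omega>. ennpowr (q (X [] \<omega>)) p \<partial>M") auto
  show ?thesis
  proof (cases "p \<le> 1")
    case True
    obtain r where r: "(\<integral>\<^sup>+\<omega>. offspring_weight p (X [] \<omega>) \<partial>M) = ennreal r" "0 \<le> r" "r < 1"
      using powr by (cases "\<integral>\<^sup>+\<omega>. offspring_weight p (X [] \<omega>) \<partial>M") auto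
    have "(\<integral>\<^sup>+\<omega>. ennpowr (level_sum q n \<omega>) p \<partial>M) \<le> ennreal (k * r ^ n)" for n
      using level_sum_moment_le_one[OF p True q, of n] k r
      by (simp add: ennreal_mult ennreal_power mult.commute)
    then show ?thesis
      using p True k r measurable_level_sum[OF q]
      by (intro moment_suminf_finite_le_one[where D = k and \<eta> = r]) auto
  next
    case False
    then have p1: "1 < p" by simp
    from level_weight_moment_geometric[OF p1 gt_one(1)[OF p1] powr gt_one(2)[OF p1]]
    obtain D \<eta> :: real where D: "0 \<le> D" "0 < \<eta>" "\<eta> < 1"
      "\<And>n. (\<integral>\<^sup>+\<omega>. ennpowr (level_sum (\<lambda>_. 1) n \<omega>) p \<partial>M) \<le> ennreal (D * \<eta> ^ n)" by metis
    have "(\<integral>\<^sup>+\<omega>. ennpowr (level_sum q n \<omega>) p \<partial>M) \<le> ennreal (D * k * \<eta> ^ n)" for n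
    proof -
      have "(\<integral>\<^sup>+\<omega>. ennpowr (level_sum q n \<omega>) p \<partial>M) \<le> ennreal (D * \<eta> ^ n) * ennreal k"
        using level_sum_moment_Jensen[OF p1 q, of n] mult_right_mono[OF D(4)[of n], of "ennreal k"]
        unfolding k(1) by (rule order_trans) simp
      then show ?thesis using D k by (simp add: ennreal_mult[symmetric] mult_ac)
    qed
    then show ?thesis
      using p1 k D measurable_level_sum[OF q]
      by (intro moment_suminf_finite_gt_one[where D = "D * k" and \<eta> = \<eta>]) auto
  qed
qed

end

section \<open>The tree of the marks (Q, N, C)\<close>

definition child_weight :: "nat \<Rightarrow> real \<times> enat \<times> (nat \<Rightarrow> real) \<Rightarrow> ennreal" where
  "child_weight j m = (if enat j \<le> fst (snd m) then ennreal (snd (snd m) j) else 0)"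

lemma measurable_mark_coordinate:
  "1 \<le> j \<Longrightarrow> (\<lambda>m. snd (snd m) j) \<in> borel_measurable mark_space"
  unfolding mark_space_def
  by (rule measurable_compose[OF measurable_snd], rule measurable_compose[OF measurable_snd],
      rule measurable_component_singleton) simp

lemma measurable_mark_fst: "fst \<in> borel_measurable mark_space"
  unfolding mark_space_def by (rule measurable_fst)

lemma measurable_mark_offspring: "(\<lambda>m. fst (snd m)) \<in> measurable mark_space (count_space UNIV)"
  unfolding mark_space_def
  by (rule measurable_compose[OF measurable_snd], rule measurable_fst)

lemma measurable_mark_pred_offspring: "Measurable.pred mark_space (\<lambda>m. enat j \<le> fst (snd m))"
  using measurable_compose[OF measurable_mark_offspring, of "\<lambda>n. enat j \<le> n" "count_space UNIV"]
  by simp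

lemma measurable_child_weight_mark:
  assumes "1 \<le> j" shows "child_weight j \<in> borel_measurable mark_space"
proof -
  note [measurable] = measurable_mark_pred_offspring measurable_mark_coordinate[OF assms]
  show ?thesis unfolding child_weight_def[abs_def] by measurable
qed

lemma child_weight_mark:
  "1 \<le> j \<Longrightarrow> child_weight j (mark Q N C v \<omega>)
    = (if enat j \<le> N v \<omega> then ennreal (C (v @ [j]) \<omega>) else 0)"
  by (simp add: child_weight_def mark_def)

lemma A_subset_level: "A N \<omega> n \<subseteq> level n"
proof (induction n)
  case (Suc n)
  then show ?case by (fastforce simp: level_def U_def)
qed simp

lemma snoc_in_A_iff:
  "v @ [j] \<in> A N \<omega> (Suc n) \<longleftrightarrow> v \<in> A N \<omega> n \<and> 1 \<le> j \<and> enat j \<le> N v \<omega>"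
  by auto

locale iid_weighted_tree = prob_space M for M :: "'a measure" +
  fixes Q C :: "nat list \<Rightarrow> 'a \<Rightarrow> real" and N :: "nat list \<Rightarrow> 'a \<Rightarrow> enat"
  assumes iid: "iid_marks M Q N C"
    and nonneg: "AE \<omega> in M. 0 \<le> Q [] \<omega> \<and> (\<forall>j\<ge>1. 0 \<le> C [j] \<omega>)"
begin

sublocale weighted_branching_tree M mark_space "mark Q N C" child_weight
  using iid by unfold_locales (auto simp: iid_marks_def measurable_child_weight_mark)

text \<open>
  Nonnegativity is a property of the law of the mark, hence passes from the root to all of the countably
  many nodes.
\<close>
lemma AE_nonneg:
  "AE \<omega> in M. \<forall>v\<in>U. 0 \<le> Q v \<omega> \<and> (\<forall>j\<in>{1..}. 0 \<le> C (v @ [j]) \<omega>)"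
proof (rule AE_ball_countable')
  fix v assume v: "v \<in> U"
  define P where "P m \<longleftrightarrow> 0 \<le> fst m \<and> (\<forall>j\<in>{1..}. 0 \<le> snd (snd m) j)"
    for m :: "real \<times> enat \<times> (nat \<Rightarrow> real)"
  have P: "{m \<in> space mark_space. P m} \<in> sets mark_space"
  proof -
    have "{m \<in> space mark_space. 0 \<le> snd (snd m) j} \<in> sets mark_space" if "j \<in> {1..}" for j
    proof -
      have [measurable]: "(\<lambda>m. snd (snd m) j) \<in> borel_measurable mark_space"
        using that by (intro measurable_mark_coordinate) simp
      show ?thesis by measurable
    qed
    then have "{m \<in> space mark_space. \<forall>j\<in>{1..}. 0 \<le> snd (snd m) j} \<in> sets mark_space"
      by (intro sets.sets_Collect_countable_All') auto
    moreover have "{m \<in> space mark_space. 0 \<le> fst m} \<in> sets mark_space"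
      using measurable_mark_fst by measurable
    ultimately show ?thesis unfolding P_def by (rule sets.sets_Collect_conj)
  qed
  have iff: "(AE m in distr M mark_space (mark Q N C u). P m) \<longleftrightarrow> (AE \<omega> in M. P (mark Q N C u \<omega>))"
    if "u \<in> U" for u
    by (rule AE_distr_iff[OF measurable_mark[OF that] P])
  have "AE \<omega> in M. P (mark Q N C [] \<omega>)"
    using nonneg by (auto simp: P_def mark_def)
  then have "AE \<omega> in M. P (mark Q N C v \<omega>)"
    using iff[OF v] iff[OF Nil_in_U] unfolding distr_mark[OF v] by blast
  then show "AE \<omega> in M. 0 \<le> Q v \<omega> \<and> (\<forall>j\<in>{1..}. 0 \<le> C (v @ [j]) \<omega>)"
    by (auto simp: P_def mark_def)
qed (rule countableI_type)

lemma measurable_Q: "v \<in> U \<Longrightarrow> Q v \<in> borel_measurable M"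
  using measurable_compose[OF measurable_mark measurable_mark_fst] by (simp add: mark_def)

lemma measurable_C: "v \<in> U \<Longrightarrow> 1 \<le> j \<Longrightarrow> C (v @ [j]) \<in> borel_measurable M"
  using measurable_compose[OF measurable_mark measurable_mark_coordinate, of v j] by (simp add: mark_def)

lemma measurable_weight: "v \<in> U \<Longrightarrow> (\<lambda>\<omega>. weight C \<omega> v) \<in> borel_measurable M"
proof (induction v rule: rev_induct)
  case (snoc j v)
  then have [measurable]: "(\<lambda>\<omega>. weight C \<omega> v) \<in> borel_measurable M" "C (v @ [j]) \<in> borel_measurable M"
    using measurable_C by (auto simp: U_def)
  show ?case by simp
qed simp

lemma measurable_in_A: "v \<in> U \<Longrightarrow> Measurable.pred M (\<lambda>\<omega>. v \<in> A N \<omega> (length v))"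
proof (induction v rule: rev_induct)
  case (snoc j v)
  then have [measurable]: "Measurable.pred M (\<lambda>\<omega>. v \<in> A N \<omega> (length v))"
    by (auto simp: U_def)
  have "v \<in> U" using snoc.prems by (auto simp: U_def)
  then have [measurable]: "Measurable.pred M (\<lambda>\<omega>. enat j \<le> N v \<omega>)"
    using measurable_compose[OF measurable_mark measurable_mark_pred_offspring] by (simp add: mark_def)
  show ?case by (simp add: snoc_in_A_iff del: A.simps)
qed simp

lemma W_conv_nn_integral: "W Q N C n \<omega> = (\<integral>\<^sup>+v. ennreal (Q v \<omega> * weight C \<omega> v) \<partial>count_space (A N \<omega> n))"
  unfolding W_def by (rule infsum_ennreal_eq_nn_integral) (rule countableI_type)

text \<open>
  Measurability of \<open>W\<close> itself, and not just of an almost everywhere equal version: there may be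
  \<open>\<omega>\<close> at which the marks are negative.
\<close>
lemma measurable_W [measurable]: "W Q N C n \<in> borel_measurable M"
proof -
  have "W Q N C n \<omega> = (\<integral>\<^sup>+v. (if v \<in> A N \<omega> (length v) then ennreal (Q v \<omega> * weight C \<omega> v) else 0) \<partial>count_space (level n))" for \<omega>
  proof -
    have "W Q N C n \<omega> = (\<integral>\<^sup>+v. (if v \<in> A N \<omega> (length v) then ennreal (Q v \<omega> * weight C \<omega> v) else 0) \<partial>count_space (A N \<omega> n))"
      unfolding W_conv_nn_integral using A_subset_level[of N \<omega> n]
      by (intro nn_integral_cong) (auto simp: level_def)
    also have "\<dots> = (\<integral>\<^sup>+v. (if v \<in> A N \<omega> (length v) then ennreal (Q v \<omega> * weight C \<omega> v) else 0) \<partial>count_space (level n))"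
      using A_subset_level[of N \<omega> n] by (intro nn_integral_count_space_eq) (auto simp: level_def)
    finally show ?thesis .
  qed
  moreover have "(\<lambda>\<omega>. \<integral>\<^sup>+v. (if v \<in> A N \<omega> (length v) then ennreal (Q v \<omega> * weight C \<omega> v) else 0) \<partial>count_space (level n)) \<in> borel_measurable M"
  proof (rule borel_measurable_nn_integral_count_space)
    fix v assume "v \<in> level n"
    then have v: "v \<in> U" by (simp add: level_def)
    note [measurable] = measurable_Q[OF v] measurable_weight[OF v] measurable_in_A[OF v]
    show "(\<lambda>\<omega>. if v \<in> A N \<omega> (length v) then ennreal (Q v \<omega> * weight C \<omega> v) else 0) \<in> borel_measurable M"
      by measurable
  qed simp
  ultimately show ?thesis by (simp add: measurable_cong[of M "W Q N C n"])
qed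

text \<open>
  Where the marks are nonnegative, the conversion to extended nonnegative reals is multiplicative, and
  the abstract weights vanish exactly off the tree or where the true weight is 0.
\<close>
lemma path_weight_eq:
  assumes nn: "\<forall>v\<in>U. \<forall>j\<in>{1..}. 0 \<le> C (v @ [j]) \<omega>" and "v \<in> U"
  shows "0 \<le> weight C \<omega> v \<and>
    path_weight v \<omega> = (if v \<in> A N \<omega> (length v) then ennreal (weight C \<omega> v) else 0)"
  using \<open>v \<in> U\<close>
proof (induction v rule: rev_induct)
  case (snoc j v)
  then have v: "v \<in> U" "1 \<le> j" by (auto simp: U_def)
  then have "0 \<le> C (v @ [j]) \<omega>" using nn by auto
  with snoc.IH[OF v(1)] v(2) show ?case
    unfolding path_weight_snoc
    by (auto simp: child_weight_mark snoc_in_A_iff ennreal_mult mult.commute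
        simp del: A.simps)
qed simp

lemma W_eq_level_sum:
  "AE \<omega> in M. \<forall>n. W Q N C n \<omega> = level_sum (\<lambda>m. ennreal (fst m)) n \<omega>"
  using AE_nonneg
proof eventually_elim
  case (elim \<omega>)
  then have nn: "\<forall>v\<in>U. \<forall>j\<in>{1..}. 0 \<le> C (v @ [j]) \<omega>" by blast
  show ?case
  proof
    fix n
    have "W Q N C n \<omega> = (\<integral>\<^sup>+v. path_weight v \<omega> * ennreal (fst (mark Q N C v \<omega>)) \<partial>count_space (A N \<omega> n))"
      unfolding W_conv_nn_integral
    proof (intro nn_integral_cong)
      fix v assume "v \<in> space (count_space (A N \<omega> n))"
      then have v: "v \<in> A N \<omega> n" "v \<in> U" "length v = n"
        using A_subset_level[of N \<omega> n] by (auto simp: level_def)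
      then show "ennreal (Q v \<omega> * weight C \<omega> v) = path_weight v \<omega> * ennreal (fst (mark Q N C v \<omega>))"
        using path_weight_eq[OF nn v(2)] elim by (simp add: mark_def ennreal_mult mult.commute)
    qed
    also have "\<dots> = level_sum (\<lambda>m. ennreal (fst m)) n \<omega>"
      unfolding level_sum_def using A_subset_level[of N \<omega> n] path_weight_eq[OF nn]
      by (intro nn_integral_count_space_eq) (auto simp: level_def)
    finally show "W Q N C n \<omega> = level_sum (\<lambda>m. ennreal (fst m)) n \<omega>" .
  qed
qed

lemma offspring_sum_eq:
  "AE \<omega> in M. offspring_sum N C p \<omega> = offspring_weight p (mark Q N C [] \<omega>)"
  using nonneg
proof eventually_elim
  case (elim \<omega>)
  let ?J = "{j. 1 \<le> j \<and> enat j \<le> N [] \<omega>}"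
  have "offspring_sum N C p \<omega> = (\<integral>\<^sup>+j. ennreal (C [j] \<omega> powr p) \<partial>count_space ?J)"
    unfolding offspring_sum_def by (rule infsum_ennreal_eq_nn_integral) (rule countableI_type)
  also have "\<dots> = (\<integral>\<^sup>+j. ennpowr (child_weight j (mark Q N C [] \<omega>)) p \<partial>count_space ?J)"
    using elim by (intro nn_integral_cong) (auto simp: child_weight_mark ennpowr_ennreal)
  also have "\<dots> = offspring_weight p (mark Q N C [] \<omega>)"
    unfolding offspring_weight_def
    by (intro nn_integral_count_space_eq) (auto simp: child_weight_mark)
  finally show ?case .
qed

end

section \<open>Moments and convergence of the total weight\<close>

lemma ennpowr_tendsto_0:
  assumes f: "(f \<longlongrightarrow> 0) F" and p: "0 < p"
  shows "((\<lambda>x. ennpowr (f x) p) \<longlongrightarrow> 0) F"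
proof (rule order_tendstoI)
  fix e :: ennreal assume "0 < e"
  then have "0 < ennpowr e (1 / p)" by (simp add: zero_less_iff_neq_zero)
  with f have "\<forall>\<^sub>F x in F. f x < ennpowr e (1 / p)" by (rule order_tendstoD)
  then show "\<forall>\<^sub>F x in F. ennpowr (f x) p < e"
  proof eventually_elim
    case (elim x)
    show ?case
    proof (rule ccontr)
      assume "\<not> ennpowr (f x) p < e"
      then have "ennpowr e (1 / p) \<le> ennpowr (ennpowr (f x) p) (1 / p)"
        using p by (intro ennpowr_mono) auto
      with elim p show False by (simp add: ennpowr_ennpowr)
    qed
  qed
qed simp

lemma converges_in_LpI_dominated:
  fixes F :: "nat \<Rightarrow> 'a \<Rightarrow> ennreal" and G :: "'a \<Rightarrow> ennreal"
  assumes F: "\<And>n. F n \<in> borel_measurable M" and G: "G \<in> borel_measurable M"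
    and le: "\<And>n \<omega>. F n \<omega> \<le> G \<omega>" and lim: "\<And>\<omega>. (\<lambda>n. F n \<omega>) \<longlonglongrightarrow> G \<omega>"
    and p: "0 < p" and fin: "(\<integral>\<^sup>+\<omega>. ennpowr (G \<omega>) p \<partial>M) < \<top>"
  shows "converges_in_Lp M p (\<lambda>n \<omega>. enn2real (F n \<omega>)) (\<lambda>\<omega>. enn2real (G \<omega>))"
proof -
  note [measurable] = F G
  have "AE \<omega> in M. ennpowr (G \<omega>) p \<noteq> \<infinity>"
    using fin by (intro nn_integral_noteq_infinite) auto
  then have G_fin: "AE \<omega> in M. G \<omega> < \<top>" by (simp add: less_top)
  have in_Lp: "in_Lp M p (\<lambda>\<omega>. enn2real (H \<omega>))"
    if [measurable]: "H \<in> borel_measurable M" and H: "\<And>\<omega>. H \<omega> \<le> G \<omega>" for H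
  proof -
    have "ennreal (\<bar>enn2real h\<bar> powr p) \<le> ennpowr h p" for h
      by (cases h) (simp_all add: ennpowr_ennreal)
    then have "(\<integral>\<^sup>+\<omega>. ennreal (\<bar>enn2real (H \<omega>)\<bar> powr p) \<partial>M) \<le> (\<integral>\<^sup>+\<omega>. ennpowr (G \<omega>) p \<partial>M)"
      using H p by (intro nn_integral_mono) (blast intro: order_trans ennpowr_mono)
    with fin show ?thesis by (auto simp: in_Lp_def Lp_norm_def)
  qed
  have "(\<lambda>n. \<integral>\<^sup>+\<omega>. ennreal (\<bar>enn2real (F n \<omega>) - enn2real (G \<omega>)\<bar> powr p) \<partial>M) \<longlonglongrightarrow> (\<integral>\<^sup>+\<omega>. 0 \<partial>M)"
  proof (rule nn_integral_dominated_convergence[where w = "\<lambda>\<omega>. ennpowr (G \<omega>) p"])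
    show "AE \<omega> in M. ennreal (\<bar>enn2real (F n \<omega>) - enn2real (G \<omega>)\<bar> powr p) \<le> ennpowr (G \<omega>) p" for n
      using G_fin
    proof eventually_elim
      case (elim \<omega>)
      have "enn2real (F n \<omega>) \<le> enn2real (G \<omega>)" using le elim by (intro enn2real_mono) auto
      then have "\<bar>enn2real (F n \<omega>) - enn2real (G \<omega>)\<bar> powr p \<le> enn2real (G \<omega>) powr p"
        using p by (intro powr_mono2) auto
      then show ?case using elim by (simp add: ennpowr_def ennreal_leI)
    qed
    show "AE \<omega> in M. (\<lambda>n. ennreal (\<bar>enn2real (F n \<omega>) - enn2real (G \<omega>)\<bar> powr p)) \<longlonglongrightarrow> 0"
      using G_fin
    proof eventually_elim
      case (elim \<omega>)
      have "(\<lambda>n. enn2real (F n \<omega>)) \<longlonglongrightarrow> enn2real (G \<omega>)"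
        using lim[of \<omega>] elim by (intro tendsto_enn2real) (auto simp: less_top)
      then have "(\<lambda>n. \<bar>enn2real (F n \<omega>) - enn2real (G \<omega>)\<bar>) \<longlonglongrightarrow> 0"
        by (simp add: LIM_zero tendsto_rabs_zero)
      then have "(\<lambda>n. \<bar>enn2real (F n \<omega>) - enn2real (G \<omega>)\<bar> powr p) \<longlonglongrightarrow> 0"
        by (rule tendsto_zero_powrI[OF _ tendsto_const]) (use p in auto)
      then show ?case by (simp add: tendsto_ennrealI[where x = 0, simplified])
    qed
  qed (use fin in auto)
  then have "(\<lambda>n. Lp_norm M p (\<lambda>\<omega>. enn2real (F n \<omega>) - enn2real (G \<omega>))) \<longlonglongrightarrow> 0"
    unfolding Lp_norm_def using p by (intro ennpowr_tendsto_0) auto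
  then show ?thesis
    unfolding converges_in_Lp_def using in_Lp[OF F le] in_Lp[OF G order_refl] by blast
qed

theorem lemma4p4:
  fixes M :: "'a measure"
    and Q C :: "nat list \<Rightarrow> 'a \<Rightarrow> real"
    and N :: "nat list \<Rightarrow> 'a \<Rightarrow> enat"
    and \<beta> :: real
  assumes "prob_space M"
    and "iid_marks M Q N C"
    and "AE \<omega> in M. 0 \<le> Q [] \<omega> \<and> (\<forall>j\<ge>1. 0 \<le> C [j] \<omega>)"
    and "0 < measure M {\<omega> \<in> space M. 0 < Q [] \<omega>}"
    and "0 < \<beta>"
    and "(\<integral>\<^sup>+\<omega>. ennreal (Q [] \<omega> powr \<beta>) \<partial>M) < \<infinity>"
    and "(\<beta> < 1 \<and> rho M N C \<beta> < 1) \<or>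
         (1 \<le> \<beta> \<and> max (rho M N C 1) (rho M N C \<beta>) < 1 \<and>
          (\<integral>\<^sup>+\<omega>. ennpowr (offspring_sum N C 1 \<omega>) \<beta> \<partial>M) < \<infinity>)"
  shows "(\<forall>\<gamma>. 0 < \<gamma> \<and> \<gamma> \<le> \<beta> \<longrightarrow> (\<integral>\<^sup>+\<omega>. ennpowr (R Q N C \<omega>) \<gamma> \<partial>M) < \<infinity>) \<and>
         (AE \<omega> in M. R Q N C \<omega> < \<infinity>) \<and>
         (1 \<le> \<beta> \<longrightarrow>
            converges_in_Lp M \<beta>
              (\<lambda>n \<omega>. enn2real (R_part Q N C n \<omega>)) (\<lambda>\<omega>. enn2real (R Q N C \<omega>)))"
proof -
  interpret prob_space M by fact
  interpret iid_weighted_tree M Q C N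
    using assms(2,3) by unfold_locales
  have R_meas [measurable]: "R Q N C \<in> borel_measurable M"
    unfolding R_def[abs_def] by measurable
  have rho: "(\<integral>\<^sup>+\<omega>. offspring_weight p (mark Q N C [] \<omega>) \<partial>M) = rho M N C p" for p
    unfolding rho_def using offspring_sum_eq[of p] by (intro nn_integral_cong_AE) auto
  have Q_moment: "(\<integral>\<^sup>+\<omega>. ennpowr (ennreal (fst (mark Q N C [] \<omega>))) \<beta> \<partial>M) < \<top>"
  proof -
    have "(\<integral>\<^sup>+\<omega>. ennpowr (ennreal (fst (mark Q N C [] \<omega>))) \<beta> \<partial>M)
        = (\<integral>\<^sup>+\<omega>. ennreal (Q [] \<omega> powr \<beta>) \<partial>M)"
      using nonneg by (intro nn_integral_cong_AE) (auto simp: mark_def ennpowr_ennreal)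
    then show ?thesis using assms(6) by simp
  qed
  have offspring_moment: "(\<integral>\<^sup>+\<omega>. ennpowr (offspring_weight 1 (mark Q N C [] \<omega>)) \<beta> \<partial>M) < \<top>" if "1 < \<beta>"
  proof -
    have "(\<integral>\<^sup>+\<omega>. ennpowr (offspring_weight 1 (mark Q N C [] \<omega>)) \<beta> \<partial>M)
        = (\<integral>\<^sup>+\<omega>. ennpowr (offspring_sum N C 1 \<omega>) \<beta> \<partial>M)"
      using offspring_sum_eq[of 1] by (intro nn_integral_cong_AE) auto
    then show ?thesis using assms(7) that by simp
  qed
  have "(\<integral>\<^sup>+\<omega>. ennpowr (\<Sum>n. level_sum (\<lambda>m. ennreal (fst m)) n \<omega>) \<beta> \<partial>M) < \<top>"
    using assms(5,7) Q_moment offspring_moment measurable_mark_fst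
    by (intro total_moment_finite) (auto simp: rho)
  also have "(\<integral>\<^sup>+\<omega>. ennpowr (\<Sum>n. level_sum (\<lambda>m. ennreal (fst m)) n \<omega>) \<beta> \<partial>M) = (\<integral>\<^sup>+\<omega>. ennpowr (R Q N C \<omega>) \<beta> \<partial>M)"
    using W_eq_level_sum by (intro nn_integral_cong_AE) (auto simp: R_def)
  finally have fin: "(\<integral>\<^sup>+\<omega>. ennpowr (R Q N C \<omega>) \<beta> \<partial>M) < \<top>" .
  have moments: "(\<integral>\<^sup>+\<omega>. ennpowr (R Q N C \<omega>) \<gamma> \<partial>M) < \<infinity>" if "0 < \<gamma>" "\<gamma> \<le> \<beta>" for \<gamma>
  proof -
    have "(\<integral>\<^sup>+\<omega>. ennpowr (R Q N C \<omega>) \<gamma> \<partial>M) \<le> (\<integral>\<^sup>+\<omega>. 1 + ennpowr (R Q N C \<omega>) \<beta> \<partial>M)"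
      by (intro nn_integral_mono ennpowr_le_one_plus that)
    also have "\<dots> = 1 + (\<integral>\<^sup>+\<omega>. ennpowr (R Q N C \<omega>) \<beta> \<partial>M)"
      by (simp add: nn_integral_add emeasure_space_1)
    also have "\<dots> < \<infinity>" using fin by (simp add: ennreal_add_less_top)
    finally show ?thesis .
  qed
  have "AE \<omega> in M. ennpowr (R Q N C \<omega>) \<beta> \<noteq> \<infinity>"
    using fin by (intro nn_integral_noteq_infinite) auto
  then have R_fin: "AE \<omega> in M. R Q N C \<omega> < \<infinity>" by (simp add: less_top)
  have "converges_in_Lp M \<beta> (\<lambda>n \<omega>. enn2real (R_part Q N C n \<omega>)) (\<lambda>\<omega>. enn2real (R Q N C \<omega>))"
  proof (rule converges_in_LpI_dominated)
    show "R_part Q N C n \<in> borel_measurable M" for n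
      unfolding R_part_def[abs_def] by measurable
    show "R_part Q N C n \<omega> \<le> R Q N C \<omega>" for n \<omega>
      unfolding R_part_def R_def by (intro sum_le_suminf) auto
    show "(\<lambda>n. R_part Q N C n \<omega>) \<longlonglongrightarrow> R Q N C \<omega>" for \<omega>
      using summable_LIMSEQ'[of "\<lambda>k. W Q N C k \<omega>"] by (simp add: R_part_def R_def atLeast0AtMost)
  qed (use assms fin in auto)
  with moments R_fin show ?thesis by simp
qed

end
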